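(* Let $U=\{1,\dots,N\}$ and consider a collection of $m$ sets $A_1,\dots,A_m\subseteq U$ that is updated by an arbitrary (not necessarily legal) stream of insertions and deletions of elements. Let $k\ge 1$, let $\ell=\Theta(\log N)$, and let $h_1,\dots,h_k$ be sampled independently and uniformly at random from a family of $\varepsilon$-$\ell$-min-wise independent hash functions $U\to U$ with $\varepsilon=O(1)$. Then the $\ell$-buffered $k$-MinHash data structure (with the init, insert, delete operations described in the context) maintains the $k$-MinHash signatures of all sets of the collection with the following guarantees: (1) it uses $O(k\log N)$ memory words per set; (2) any sequence of update operations takes $O(k\log N)$ amortized time per operation, with high probability with respect to the maximum size of the sets in the collection; (3) for each set $A$ of the collection it returns in time $O(k)$ the vector $(\min_{a\in A}h_1(a),\dots,\min_{a\in A}h_k(a))$, i.e. exactly the $k$-MinHash signature of the current set $A$.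
   Context: A family $\mathcal H$ of hash functions on $U=\{1,\dots,N\}$ is $\varepsilon$-$d$-min-wise independent ($0<\varepsilon<1$, $2\le d\le N$) if for every $A\subseteq U$ and every $X\subseteq A$ with $|X|=d$, $\Pr_{h\in\mathcal H}[\max h(X)\le \min h(A\setminus X)]=(1\pm\varepsilon)/\binom{|A|}{|X|}$. Such a function can be stored in $O(d\log\log(1/\varepsilon)+\log(1/\varepsilon))$ space and evaluated in $O(d\log(1/\varepsilon))$ time. For a hash function $h$ and $A\subseteq U$, let $H(A,h)=\{(h(x),x): x\in A\}$, ordered lexicographically: $(h(x),x)\le(h(y),y)$ iff $h(x)<h(y)$, or $h(x)=h(y)$ and $x\le y$. $\mathrm{Smallest}(X,r)$ denotes the set of the $r$ smallest elements of $X$ (or $X$ itself if $|X|\le r$). The $\ell$-buffered $k$-MinHash of $A$ is a vector $(S_1(A),\dots,S_k(A))$ with $S_i(A)=\langle \mathcal B_{A,i},\delta_{A,i}\rangle$, where $\mathcal B_{A,i}\subseteq H(A,h_i)$ (stored as a balanced binary search tree) and $\delta_{A,i}\in (U\cup\{+\infty\})^2$, satisfying: (i) for all $x\in A$, $(h_i(x),x)\in\mathcal B_{A,i}$ iff $(h_i(x),x)\le\delta_{A,i}$; (ii) $|\mathcal B_{A,i}|\le\ell$; (iii) $\mathcal B_{A,i}=\emptyset$ iff $A=\emptyset$, in which case $\delta_{A,i}=(+\infty,+\infty)$. Operations: init$(A)$: for each $i$, set $\mathcal B_{A,i}=\mathrm{Smallest}(H(A,h_i),\ell)$ and $\delta_{A,i}=\max\mathcal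 B_{A,i}$ if $|\mathcal B_{A,i}|=\ell$, else $(+\infty,+\infty)$. insert$(x)$: for each $i$ with $(h_i(x),x)\le\delta_{A,i}$, set $\mathcal B_{A,i}\leftarrow\mathrm{Smallest}(\mathcal B_{A,i}\cup\{(h_i(x),x)\},\ell)$ and, if now $|\mathcal B_{A,i}|=\ell$, set $\delta_{A,i}=\max\mathcal B_{A,i}$. delete$(x)$: for each $i$, remove $(h_i(x),x)$ from $\mathcal B_{A,i}$; if some $\mathcal B_{A,i}$ becomes empty (a "fault"), obtain the current set $A$ via a recovery query (a stream of its elements) and re-run init on it, which costs time proportional to the cost of $|A|$ insertions. The signature is read as $\min\mathcal B_{A,i}$ for each $i$.
   Formalization: In (2) the failure probability is max(1, k/N^q)/n^c for any constants c, q (n the maximum set size), i.e. 1/n^c for k ≤ N^q; for k superpolynomial in N the claim fails with full re-initialisation. ε = O(1) is read as ε bounded below by a positive constant. *)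

theory Defs
  imports "HOL-Probability.Probability" "HOL-Library.Tree" "HOL-Library.Extended_Nat"
begin

subsection \<open>Min-wise independent families of hash functions\<close>

text \<open>
  A family is a finite nonempty set of functions mapping \<open>{1..N}\<close> to itself; their values outside
  \<open>{1..N}\<close> are irrelevant, so that a hash function may occur in the family with repetitions. The
  minimum over the empty set is \<open>\<infinity>\<close>, which is why the event is certain for \<open>A - X = {}\<close>.
\<close>

definition min_wise_family :: "nat \<Rightarrow> real \<Rightarrow> nat \<Rightarrow> (nat \<Rightarrow> nat) set \<Rightarrow> bool" where
  "min_wise_family N \<epsilon> d \<H> \<longleftrightarrow>
     0 < \<epsilon> \<and> \<epsilon> < 1 \<and> 2 \<le> d \<and> d \<le> N \<and>
     finite \<H> \<and> \<H> \<noteq> {} \<and> \<H> \<subseteq> {1..N} \<rightarrow> {1..N} \<and>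
     (\<forall>A X. A \<subseteq> {1..N} \<longrightarrow> X \<subseteq> A \<longrightarrow> card X = d \<longrightarrow>
        measure_pmf.prob (pmf_of_set \<H>)
            {h. A - X = {} \<or> Max (h ` X) \<le> Min (h ` (A - X))}
          \<in> {(1 - \<epsilon>) / real (card A choose card X) .. (1 + \<epsilon>) / real (card A choose card X)})"

text \<open>Hash value of a set; the empty set, which has no minimum, is assigned \<open>\<infinity>\<close>.\<close>

definition minhash :: "(nat \<Rightarrow> nat) \<Rightarrow> nat set \<Rightarrow> enat" where
  "minhash h A = (if A = {} then \<infinity> else enat (Min (h ` A)))"


subsection \<open>Entries\<close>

text \<open>
  Pairs (hash value, element), ordered lexicographically. A separate type is used because the
  order on \<^typ>\<open>enat \<times> enat\<close> provided by the analysis library is the componentwise one.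
  Components \<open>\<infinity>\<close> occur only in thresholds.
\<close>

datatype entry = Entry (hval: enat) (elt: enat)

instantiation entry :: linorder
begin

definition less_eq_entry :: "entry \<Rightarrow> entry \<Rightarrow> bool" where
  "p \<le> q \<longleftrightarrow> hval p < hval q \<or> hval p = hval q \<and> elt p \<le> elt q"

definition less_entry :: "entry \<Rightarrow> entry \<Rightarrow> bool" where
  "p < q \<longleftrightarrow> hval p < hval q \<or> hval p = hval q \<and> elt p < elt q"

instance
  by standard (auto simp: less_eq_entry_def less_entry_def entry.expand)

end

abbreviation entry_of :: "(nat \<Rightarrow> nat) \<Rightarrow> nat \<Rightarrow> entry" where
  "entry_of h x \<equiv> Entry (enat (h x)) (enat x)"

abbreviation infinite_entry :: entry where
  "infinite_entry \<equiv> Entry \<infinity> \<infinity>"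

definition hash_pairs :: "nat set \<Rightarrow> (nat \<Rightarrow> nat) \<Rightarrow> entry set" where
  "hash_pairs A h = entry_of h ` A"

definition smallest :: "entry set \<Rightarrow> nat \<Rightarrow> entry set" where
  "smallest X r = {p \<in> X. card {q \<in> X. q < p} < r}"


subsection \<open>Balanced search trees\<close>

text \<open>
  AVL trees: every node carries the height of the subtree below it. A function \<open>T_f\<close> counts the
  calls of the recursive functions during the evaluation of \<open>f\<close>. Comparisons, pointer manipulations
  and non-recursive functions such as \<open>rebalance\<close> take constant time and are covered by the unit
  charged to the call in which they occur.
\<close>

type_synonym 'a avl = "('a \<times> nat) tree"

definition keys :: "'a avl \<Rightarrow> 'a list" where
  "keys t = map fst (inorder t)"

definition search_tree :: "'a::linorder avl \<Rightarrow> bool" where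
  "search_tree t \<longleftrightarrow> sorted_wrt (<) (keys t)"

fun avl :: "'a avl \<Rightarrow> bool" where
  "avl \<langle>\<rangle> = True"
| "avl \<langle>l, (a, n), r\<rangle> \<longleftrightarrow>
     avl l \<and> avl r \<and> n = max (height l) (height r) + 1 \<and>
     height l \<le> height r + 1 \<and> height r \<le> height l + 1"

fun ht :: "'a avl \<Rightarrow> nat" where
  "ht \<langle>\<rangle> = 0"
| "ht \<langle>l, (a, n), r\<rangle> = n"

definition node :: "'a avl \<Rightarrow> 'a \<Rightarrow> 'a avl \<Rightarrow> 'a avl" where
  "node l a r = \<langle>l, (a, max (ht l) (ht r) + 1), r\<rangle>"

fun rotate_right :: "'a avl \<Rightarrow> 'a \<Rightarrow> 'a avl \<Rightarrow> 'a avl" where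
  "rotate_right \<langle>A, (a, _), B\<rangle> c C =
     (if ht B \<le> ht A then node A a (node B c C)
      else case B of
             \<langle>B\<^sub>1, (b, _), B\<^sub>2\<rangle> \<Rightarrow> node (node A a B\<^sub>1) b (node B\<^sub>2 c C)
           | \<langle>\<rangle> \<Rightarrow> node A a (node B c C))"
| "rotate_right \<langle>\<rangle> c C = node \<langle>\<rangle> c C"

fun rotate_left :: "'a avl \<Rightarrow> 'a \<Rightarrow> 'a avl \<Rightarrow> 'a avl" where
  "rotate_left A a \<langle>B, (c, _), C\<rangle> =
     (if ht B \<le> ht C then node (node A a B) c C
      else case B of
             \<langle>B\<^sub>1, (b, _), B\<^sub>2\<rangle> \<Rightarrow> node (node A a B\<^sub>1) b (node B\<^sub>2 c C)
           | \<langle>\<rangle> \<Rightarrow> node (node A a B) c C)"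
| "rotate_left A a \<langle>\<rangle> = node A a \<langle>\<rangle>"

definition rebalance :: "'a avl \<Rightarrow> 'a \<Rightarrow> 'a avl \<Rightarrow> 'a avl" where
  "rebalance l a r =
     (if ht r + 1 < ht l then rotate_right l a r
      else if ht l + 1 < ht r then rotate_left l a r
      else node l a r)"

fun avl_member :: "'a::linorder \<Rightarrow> 'a avl \<Rightarrow> bool" where
  "avl_member x \<langle>\<rangle> = False"
| "avl_member x \<langle>l, (a, n), r\<rangle> =
     (if x < a then avl_member x l else if a < x then avl_member x r else True)"

fun T_avl_member :: "'a::linorder \<Rightarrow> 'a avl \<Rightarrow> nat" where
  "T_avl_member x \<langle>\<rangle> = 1"
| "T_avl_member x \<langle>l, (a, n), r\<rangle> =
     (if x < a then T_avl_member x l else if a < x then T_avl_member x r else 0) + 1"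

fun avl_insert :: "'a::linorder \<Rightarrow> 'a avl \<Rightarrow> 'a avl" where
  "avl_insert x \<langle>\<rangle> = \<langle>\<langle>\<rangle>, (x, 1), \<langle>\<rangle>\<rangle>"
| "avl_insert x \<langle>l, (a, n), r\<rangle> =
     (if x < a then rebalance (avl_insert x l) a r
      else if a < x then rebalance l a (avl_insert x r)
      else \<langle>l, (a, n), r\<rangle>)"

fun T_avl_insert :: "'a::linorder \<Rightarrow> 'a avl \<Rightarrow> nat" where
  "T_avl_insert x \<langle>\<rangle> = 1"
| "T_avl_insert x \<langle>l, (a, n), r\<rangle> =
     (if x < a then T_avl_insert x l else if a < x then T_avl_insert x r else 0) + 1"

fun min_key :: "'a avl \<Rightarrow> 'a" where
  "min_key \<langle>\<rangle> = undefined"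
| "min_key \<langle>l, (a, n), r\<rangle> = (if l = \<langle>\<rangle> then a else min_key l)"

fun T_min_key :: "'a avl \<Rightarrow> nat" where
  "T_min_key \<langle>\<rangle> = 1"
| "T_min_key \<langle>l, (a, n), r\<rangle> = (if l = \<langle>\<rangle> then 0 else T_min_key l) + 1"

fun max_key :: "'a avl \<Rightarrow> 'a" where
  "max_key \<langle>\<rangle> = undefined"
| "max_key \<langle>l, (a, n), r\<rangle> = (if r = \<langle>\<rangle> then a else max_key r)"

fun T_max_key :: "'a avl \<Rightarrow> nat" where
  "T_max_key \<langle>\<rangle> = 1"
| "T_max_key \<langle>l, (a, n), r\<rangle> = (if r = \<langle>\<rangle> then 0 else T_max_key r) + 1"

fun delete_max :: "'a avl \<Rightarrow> 'a avl" where
  "delete_max \<langle>\<rangle> = \<langle>\<rangle>"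
| "delete_max \<langle>l, (a, n), r\<rangle> = (if r = \<langle>\<rangle> then l else rebalance l a (delete_max r))"

fun T_delete_max :: "'a avl \<Rightarrow> nat" where
  "T_delete_max \<langle>\<rangle> = 1"
| "T_delete_max \<langle>l, (a, n), r\<rangle> = (if r = \<langle>\<rangle> then 0 else T_delete_max r) + 1"

fun avl_delete :: "'a::linorder \<Rightarrow> 'a avl \<Rightarrow> 'a avl" where
  "avl_delete x \<langle>\<rangle> = \<langle>\<rangle>"
| "avl_delete x \<langle>l, (a, n), r\<rangle> =
     (if x < a then rebalance (avl_delete x l) a r
      else if a < x then rebalance l a (avl_delete x r)
      else if l = \<langle>\<rangle> then r
      else rebalance (delete_max l) (max_key l) r)"

fun T_avl_delete :: "'a::linorder \<Rightarrow> 'a avl \<Rightarrow> nat" where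
  "T_avl_delete x \<langle>\<rangle> = 1"
| "T_avl_delete x \<langle>l, (a, n), r\<rangle> =
     (if x < a then T_avl_delete x l
      else if a < x then T_avl_delete x r
      else if l = \<langle>\<rangle> then 0
      else T_delete_max l + T_max_key l) + 1"

text \<open>The two components of the key, the height and two pointers take one word each.\<close>

fun tree_words :: "entry avl \<Rightarrow> nat" where
  "tree_words \<langle>\<rangle> = 0"
| "tree_words \<langle>l, (a, n), r\<rangle> = tree_words l + tree_words r + 5"


subsection \<open>A single buffer\<close>

text \<open>
  \<open>buf_tree\<close> stores \<open>\<B>\<close> and \<open>buf_bound\<close> is \<open>\<delta>\<close>. The size and the minimum of \<open>\<B>\<close> are stored as well
  and maintained by the update operations, so that the minimum is read in constant time.
\<close>

record buffer =
  buf_tree :: "entry avl"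
  buf_size :: nat
  buf_min :: entry
  buf_bound :: entry

definition buf_entries :: "buffer \<Rightarrow> entry set" where
  "buf_entries b = set (keys (buf_tree b))"

text \<open>One word each for the root pointer and the size, two for each of the two entries.\<close>

definition buf_words :: "buffer \<Rightarrow> nat" where
  "buf_words b = tree_words (buf_tree b) + 6"

text \<open>What it means that \<open>b\<close> is a component \<open>\<langle>\<B>, \<delta>\<rangle>\<close> of the \<open>l\<close>-buffered MinHash of \<open>A\<close>.\<close>

definition buffered_minhash :: "nat \<Rightarrow> nat \<Rightarrow> (nat \<Rightarrow> nat) \<Rightarrow> nat set \<Rightarrow> buffer \<Rightarrow> bool" where
  "buffered_minhash N l h A b \<longleftrightarrow>
     search_tree (buf_tree b) \<and> avl (buf_tree b) \<and>
     buf_entries b \<subseteq> hash_pairs A h \<and>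
     hval (buf_bound b) \<in> insert \<infinity> (enat ` {1..N}) \<and>
     elt (buf_bound b) \<in> insert \<infinity> (enat ` {1..N}) \<and>
     (\<forall>x\<in>A. entry_of h x \<in> buf_entries b \<longleftrightarrow> entry_of h x \<le> buf_bound b) \<and>
     card (buf_entries b) \<le> l \<and>
     (buf_entries b = {} \<longleftrightarrow> A = {}) \<and>
     (A = {} \<longrightarrow> buf_bound b = infinite_entry)"

definition empty_buffer :: buffer where
  "empty_buffer =
     \<lparr>buf_tree = \<langle>\<rangle>, buf_size = 0, buf_min = infinite_entry, buf_bound = infinite_entry\<rparr>"

definition buf_insert :: "nat \<Rightarrow> entry \<Rightarrow> buffer \<Rightarrow> buffer" where
  "buf_insert l p b =
     (if p \<le> buf_bound b then
        let n = (if avl_member p (buf_tree b) then buf_size b else buf_size b + 1);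
            t = avl_insert p (buf_tree b);
            t' = (if l < n then delete_max t else t);
            n' = (if l < n then n - 1 else n)
        in \<lparr>buf_tree = t', buf_size = n', buf_min = min_key t',
            buf_bound = (if n' = l then max_key t' else buf_bound b)\<rparr>
      else b)"

definition T_buf_insert :: "nat \<Rightarrow> entry \<Rightarrow> buffer \<Rightarrow> nat" where
  "T_buf_insert l p b =
     (if p \<le> buf_bound b then
        let n = (if avl_member p (buf_tree b) then buf_size b else buf_size b + 1);
            t = avl_insert p (buf_tree b);
            t' = (if l < n then delete_max t else t);
            n' = (if l < n then n - 1 else n)
        in T_avl_member p (buf_tree b) + T_avl_insert p (buf_tree b)
           + (if l < n then T_delete_max t else 0)
           + T_min_key t' + (if n' = l then T_max_key t' else 0)
      else 0) + 1"

definition buf_delete :: "entry \<Rightarrow> buffer \<Rightarrow> buffer" where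
  "buf_delete p b =
     (if avl_member p (buf_tree b) then
        let t = avl_delete p (buf_tree b)
        in b\<lparr>buf_tree := t, buf_size := buf_size b - 1,
             buf_min := (if t = \<langle>\<rangle> then infinite_entry else min_key t)\<rparr>
      else b)"

definition T_buf_delete :: "entry \<Rightarrow> buffer \<Rightarrow> nat" where
  "T_buf_delete p b =
     T_avl_member p (buf_tree b)
     + (if avl_member p (buf_tree b) then
          let t = avl_delete p (buf_tree b)
          in T_avl_delete p (buf_tree b) + (if t = \<langle>\<rangle> then 0 else T_min_key t)
        else 0) + 1"


subsection \<open>The buffered MinHash of a set\<close>

text \<open>
  The \<open>k\<close> buffers of a set and the \<open>k\<close> hash functions are indexed by \<open>{1..k}\<close>. The parameter \<open>\<tau>\<close>
  gives the time \<open>\<tau> h x\<close> needed to evaluate \<open>h\<close> at \<open>x\<close>.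
\<close>

type_synonym sketch = "nat \<Rightarrow> buffer"
type_synonym hashes = "nat \<Rightarrow> nat \<Rightarrow> nat"
type_synonym eval_time = "(nat \<Rightarrow> nat) \<Rightarrow> nat \<Rightarrow> nat"

definition sketch_insert :: "nat \<Rightarrow> hashes \<Rightarrow> nat \<Rightarrow> sketch \<Rightarrow> sketch" where
  "sketch_insert l hs x S = (\<lambda>i. buf_insert l (entry_of (hs i) x) (S i))"

definition T_sketch_insert :: "nat \<Rightarrow> nat \<Rightarrow> eval_time \<Rightarrow> hashes \<Rightarrow> nat \<Rightarrow> sketch \<Rightarrow> nat" where
  "T_sketch_insert k l \<tau> hs x S =
     (\<Sum>i=1..k. \<tau> (hs i) x + T_buf_insert l (entry_of (hs i) x) (S i)) + 1"

text \<open>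
  Initialisation from a stream \<open>xs\<close> of the elements of \<open>A\<close> inserts them one by one into empty buffers.
  The lemma \<open>sketch_init_correct\<close> below shows that every buffer then consists of the \<open>l\<close> smallest
  pairs, with the prescribed threshold.
\<close>

primrec insert_all :: "nat \<Rightarrow> hashes \<Rightarrow> nat list \<Rightarrow> sketch \<Rightarrow> sketch" where
  "insert_all l hs [] S = S"
| "insert_all l hs (x # xs) S = insert_all l hs xs (sketch_insert l hs x S)"

primrec T_insert_all ::
    "nat \<Rightarrow> nat \<Rightarrow> eval_time \<Rightarrow> hashes \<Rightarrow> nat list \<Rightarrow> sketch \<Rightarrow> nat" where
  "T_insert_all k l \<tau> hs [] S = 1"
| "T_insert_all k l \<tau> hs (x # xs) S =
     T_sketch_insert k l \<tau> hs x S + T_insert_all k l \<tau> hs xs (sketch_insert l hs x S) + 1"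

definition sketch_init :: "nat \<Rightarrow> hashes \<Rightarrow> nat list \<Rightarrow> sketch" where
  "sketch_init l hs xs = insert_all l hs xs (\<lambda>i. empty_buffer)"

definition T_sketch_init :: "nat \<Rightarrow> nat \<Rightarrow> eval_time \<Rightarrow> hashes \<Rightarrow> nat list \<Rightarrow> nat" where
  "T_sketch_init k l \<tau> hs xs = k + T_insert_all k l \<tau> hs xs (\<lambda>i. empty_buffer)"

definition sketch_remove :: "hashes \<Rightarrow> nat \<Rightarrow> sketch \<Rightarrow> sketch" where
  "sketch_remove hs x S = (\<lambda>i. buf_delete (entry_of (hs i) x) (S i))"

definition fault :: "nat \<Rightarrow> hashes \<Rightarrow> nat \<Rightarrow> sketch \<Rightarrow> bool" where
  "fault k hs x S \<longleftrightarrow>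
     (\<exists>i\<in>{1..k}. buf_size (S i) \<noteq> 0 \<and> buf_size (sketch_remove hs x S i) = 0)"

text \<open>
  \<open>xs\<close> is the answer to the recovery query, a stream of the elements of the set after the deletion. It
  is consulted only in case of a fault, and then all \<open>k\<close> buffers of the set are initialised anew.
\<close>

definition sketch_delete :: "nat \<Rightarrow> nat \<Rightarrow> hashes \<Rightarrow> nat \<Rightarrow> nat list \<Rightarrow> sketch \<Rightarrow> sketch" where
  "sketch_delete k l hs x xs S =
     (if fault k hs x S then sketch_init l hs xs else sketch_remove hs x S)"

definition T_sketch_delete ::
    "nat \<Rightarrow> nat \<Rightarrow> eval_time \<Rightarrow> hashes \<Rightarrow> nat \<Rightarrow> nat list \<Rightarrow> sketch \<Rightarrow> nat" where
  "T_sketch_delete k l \<tau> hs x xs S =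
     (\<Sum>i=1..k. \<tau> (hs i) x + T_buf_delete (entry_of (hs i) x) (S i))
     + (if fault k hs x S then T_sketch_init k l \<tau> hs xs else 0) + 1"

primrec read_signature :: "nat list \<Rightarrow> sketch \<Rightarrow> enat list" where
  "read_signature [] S = []"
| "read_signature (i # is) S = hval (buf_min (S i)) # read_signature is S"

primrec T_read_signature :: "nat list \<Rightarrow> sketch \<Rightarrow> nat" where
  "T_read_signature [] S = 1"
| "T_read_signature (i # is) S = T_read_signature is S + 1"

definition sketch_words :: "nat \<Rightarrow> sketch \<Rightarrow> nat" where
  "sketch_words k S = (\<Sum>i=1..k. buf_words (S i))"


subsection \<open>A collection of sets under a stream of updates\<close>

text \<open>
  \<open>Insert j x\<close> and \<open>Delete j x\<close> act on the \<open>j\<close>-th set. Updates need not be legal: present elements may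
  be inserted and absent elements may be deleted.
\<close>

datatype update = Insert nat nat | Delete nat nat

primrec valid_update :: "nat \<Rightarrow> nat \<Rightarrow> update \<Rightarrow> bool" where
  "valid_update N m (Insert j x) \<longleftrightarrow> j \<in> {1..m} \<and> x \<in> {1..N}"
| "valid_update N m (Delete j x) \<longleftrightarrow> j \<in> {1..m} \<and> x \<in> {1..N}"

primrec apply_update :: "update \<Rightarrow> (nat \<Rightarrow> nat set) \<Rightarrow> nat \<Rightarrow> nat set" where
  "apply_update (Insert j x) C = C(j := insert x (C j))"
| "apply_update (Delete j x) C = C(j := C j - {x})"

text \<open>The \<open>j\<close>-th set after \<open>t\<close> updates; \<open>us t\<close> is the update number \<open>t\<close>, counted from 0.\<close>

primrec sets_at :: "(nat \<Rightarrow> nat set) \<Rightarrow> (nat \<Rightarrow> update) \<Rightarrow> nat \<Rightarrow> nat \<Rightarrow> nat set" where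
  "sets_at A\<^sub>0 us 0 = A\<^sub>0"
| "sets_at A\<^sub>0 us (Suc t) = apply_update (us t) (sets_at A\<^sub>0 us t)"

definition max_set_size :: "nat \<Rightarrow> (nat \<Rightarrow> nat set) \<Rightarrow> (nat \<Rightarrow> update) \<Rightarrow> nat \<Rightarrow> nat" where
  "max_set_size m A\<^sub>0 us T = Max {card (sets_at A\<^sub>0 us t j) | t j. t \<le> T \<and> j \<in> {1..m}}"

text \<open>
  \<open>query t A\<close> is the order in which \<open>A\<close> is streamed when it is queried after \<open>t\<close> updates (the query for
  \<open>t = 0\<close> is the one of the initialisation).
\<close>

definition valid_query :: "nat \<Rightarrow> (nat \<Rightarrow> nat set \<Rightarrow> nat list) \<Rightarrow> bool" where
  "valid_query N query \<longleftrightarrow>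
     (\<forall>t A. A \<subseteq> {1..N} \<longrightarrow> distinct (query t A) \<and> set (query t A) = A)"

primrec update_sketches ::
    "nat \<Rightarrow> nat \<Rightarrow> hashes \<Rightarrow> (nat set \<Rightarrow> nat list) \<Rightarrow> (nat \<Rightarrow> nat set) \<Rightarrow> update
       \<Rightarrow> (nat \<Rightarrow> sketch) \<Rightarrow> nat \<Rightarrow> sketch" where
  "update_sketches k l hs q C (Insert j x) D = D(j := sketch_insert l hs x (D j))"
| "update_sketches k l hs q C (Delete j x) D =
     D(j := sketch_delete k l hs x (q (C j - {x})) (D j))"

primrec T_update_sketches ::
    "nat \<Rightarrow> nat \<Rightarrow> eval_time \<Rightarrow> hashes \<Rightarrow> (nat set \<Rightarrow> nat list) \<Rightarrow> (nat \<Rightarrow> nat set) \<Rightarrow> update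
       \<Rightarrow> (nat \<Rightarrow> sketch) \<Rightarrow> nat" where
  "T_update_sketches k l \<tau> hs q C (Insert j x) D = T_sketch_insert k l \<tau> hs x (D j)"
| "T_update_sketches k l \<tau> hs q C (Delete j x) D =
     T_sketch_delete k l \<tau> hs x (q (C j - {x})) (D j)"

primrec sketches_at ::
    "nat \<Rightarrow> nat \<Rightarrow> hashes \<Rightarrow> (nat \<Rightarrow> nat set \<Rightarrow> nat list) \<Rightarrow> (nat \<Rightarrow> nat set) \<Rightarrow> (nat \<Rightarrow> update)
       \<Rightarrow> nat \<Rightarrow> nat \<Rightarrow> sketch" where
  "sketches_at k l hs query A\<^sub>0 us 0 = (\<lambda>j. sketch_init l hs (query 0 (A\<^sub>0 j)))"
| "sketches_at k l hs query A\<^sub>0 us (Suc t) =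
     update_sketches k l hs (query (Suc t)) (sets_at A\<^sub>0 us t) (us t)
       (sketches_at k l hs query A\<^sub>0 us t)"

definition total_update_time ::
    "nat \<Rightarrow> nat \<Rightarrow> eval_time \<Rightarrow> hashes \<Rightarrow> (nat \<Rightarrow> nat set \<Rightarrow> nat list) \<Rightarrow> (nat \<Rightarrow> nat set)
       \<Rightarrow> (nat \<Rightarrow> update) \<Rightarrow> nat \<Rightarrow> nat" where
  "total_update_time k l \<tau> hs query A\<^sub>0 us T =
     (\<Sum>t<T. T_update_sketches k l \<tau> hs (query (Suc t)) (sets_at A\<^sub>0 us t) (us t)
               (sketches_at k l hs query A\<^sub>0 us t))"


subsection \<open>Correctness of the buffer operations\<close>

lemma keys_simps [simp]:
  "keys \<langle>\<rangle> = []"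
  "keys \<langle>l, p, r\<rangle> = keys l @ fst p # keys r"
  by (auto simp: keys_def)

lemma keys_node [simp]: "keys (node l a r) = keys l @ a # keys r"
  by (simp add: node_def)

lemma keys_eq_Nil_iff [simp]: "keys t = [] \<longleftrightarrow> t = \<langle>\<rangle>"
  by (cases t) auto

lemma keys_rebalance [simp]:
  fixes l r :: "'a avl"
  shows "keys (rebalance l a r) = keys l @ a # keys r"
proof -
  have "keys (rotate_right l a r) = keys l @ a # keys r" for l r :: "'a avl" and a
    by (induction l a r rule: rotate_right.induct) (auto split: tree.split)
  moreover have "keys (rotate_left l a r) = keys l @ a # keys r" for l r :: "'a avl" and a
    by (induction l a r rule: rotate_left.induct) (auto split: tree.split)
  ultimately show ?thesis by (simp add: rebalance_def)
qed

lemma ht_eq_height: "avl t \<Longrightarrow> ht t = height t"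
  by (cases t rule: ht.cases) auto

lemma height_node [simp]: "height (node l a r) = max (height l) (height r) + 1"
  by (simp add: node_def)

lemma avl_node [simp]:
  "avl l \<Longrightarrow> avl r \<Longrightarrow>
     avl (node l a r) \<longleftrightarrow> height l \<le> height r + 1 \<and> height r \<le> height l + 1"
  by (simp add: node_def ht_eq_height)

lemma avl_rotate_right:
  assumes "avl l" "avl r" "height l = height r + 2"
  shows "avl (rotate_right l a r) \<and> height (rotate_right l a r) \<le> height l + 1 \<and>
           height l \<le> height (rotate_right l a r)"
proof -
  obtain A b n B where l: "l = \<langle>A, (b, n), B\<rangle>" using assms by (cases l rule: ht.cases) auto
  show ?thesis
  proof (cases "height B \<le> height A")
    case True
    then have "rotate_right l a r = node A b (node B a r)"
      using assms l by (simp add: ht_eq_height)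
    moreover have "avl A" "avl B" "height A = height r + 1"
      "height B \<le> height r + 1" "height r \<le> height B"
      using True assms l by auto
    ultimately show ?thesis using assms True by simp
  next
    case False
    then obtain C c k D where B: "B = \<langle>C, (c, k), D\<rangle>" by (cases B rule: ht.cases) auto
    have "avl A" "avl B" "height A = height r" and hB: "height B = height r + 1"
      using False assms l by auto
    moreover from this B have "avl C" "avl D" "height C \<le> height r" "height D \<le> height r"
      "height r \<le> height C + 1" "height r \<le> height D + 1" "max (height C) (height D) = height r"
      by auto
    moreover have "rotate_right l a r = node (node A b C) c (node D a r)"
      using False assms l B by (simp add: ht_eq_height)
    ultimately show ?thesis using assms(2,3) by simp
  qed
qed

lemma avl_rotate_left:
  assumes "avl l" "avl r" "height r = height l + 2"
  shows "avl (rotate_left l a r) \<and> height (rotate_left l a r) \<le> height r + 1 \<and>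
           height r \<le> height (rotate_left l a r)"
proof -
  obtain B b n C where r: "r = \<langle>B, (b, n), C\<rangle>" using assms by (cases r rule: ht.cases) auto
  show ?thesis
  proof (cases "height B \<le> height C")
    case True
    then have "rotate_left l a r = node (node l a B) b C"
      using assms r by (simp add: ht_eq_height)
    moreover have "avl C" "avl B" "height C = height l + 1"
      "height B \<le> height l + 1" "height l \<le> height B"
      using True assms r by auto
    ultimately show ?thesis using assms True by simp
  next
    case False
    then obtain D c k E where B: "B = \<langle>D, (c, k), E\<rangle>" by (cases B rule: ht.cases) auto
    have "avl C" "avl B" "height C = height l" and hB: "height B = height l + 1"
      using False assms r by auto
    moreover from this B have "avl D" "avl E" "height D \<le> height l" "height E \<le> height l"
      "height l \<le> height D + 1" "height l \<le> height E + 1" "max (height D) (height E) = height l"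
      by auto
    moreover have "rotate_left l a r = node (node l a D) c (node E b C)"
      using False assms r B by (simp add: ht_eq_height)
    ultimately show ?thesis using assms(1,3) by simp
  qed
qed

lemma avl_rebalance:
  assumes "avl l" "avl r" "height l \<le> height r + 2" "height r \<le> height l + 2"
  shows "avl (rebalance l a r)"
    and "height (rebalance l a r) \<le> max (height l) (height r) + 1"
    and "max (height l) (height r) \<le> height (rebalance l a r)"
    and "\<lbrakk>height l \<le> height r + 1; height r \<le> height l + 1\<rbrakk> \<Longrightarrow>
           height (rebalance l a r) = max (height l) (height r) + 1"
proof -
  consider "height l = height r + 2" | "height r = height l + 2"
    | "height l \<le> height r + 1" "height r \<le> height l + 1" using assms by linarith
  then have "avl (rebalance l a r) \<and> height (rebalance l a r) \<le> max (height l) (height r) + 1 \<and>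
    max (height l) (height r) \<le> height (rebalance l a r) \<and>
    (height l \<le> height r + 1 \<longrightarrow> height r \<le> height l + 1 \<longrightarrow>
       height (rebalance l a r) = max (height l) (height r) + 1)"
  proof cases
    case 1
    then have "rebalance l a r = rotate_right l a r"
      using assms by (simp add: rebalance_def ht_eq_height)
    with 1 avl_rotate_right[of l r a] assms show ?thesis by simp
  next
    case 2
    then have "rebalance l a r = rotate_left l a r"
      using assms by (simp add: rebalance_def ht_eq_height)
    with 2 avl_rotate_left[of l r a] assms show ?thesis by simp
  next
    case 3
    then have "rebalance l a r = node l a r"
      using assms by (simp add: rebalance_def ht_eq_height)
    with 3 assms show ?thesis by (auto simp: max_def)
  qed
  then show "avl (rebalance l a r)"
    and "height (rebalance l a r) \<le> max (height l) (height r) + 1"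
    and "max (height l) (height r) \<le> height (rebalance l a r)"
    and "\<lbrakk>height l \<le> height r + 1; height r \<le> height l + 1\<rbrakk> \<Longrightarrow>
           height (rebalance l a r) = max (height l) (height r) + 1"
    by auto
qed

lemma avl_insert:
  "avl t \<Longrightarrow> avl (avl_insert x t) \<and> height t \<le> height (avl_insert x t) \<and>
     height (avl_insert x t) \<le> height t + 1"
proof (induction x t rule: avl_insert.induct)
  case (2 x l a n r)
  consider "x < a" | "a < x" | "x = a" by force
  then show ?case
  proof cases
    case 1
    with 2 avl_rebalance[of "avl_insert x l" r a] show ?thesis
      by (cases "height l \<le> height r + 1 \<and> height r \<le> height l + 1 \<and> height (avl_insert x l) \<le> height r + 1 \<and> height r \<le> height (avl_insert x l) + 1")
        (auto simp: max_def split: if_splits)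
  next
    case b: 2
    with 2 avl_rebalance[of l "avl_insert x r" a] show ?thesis
      by (cases "height l \<le> height r + 1 \<and> height r \<le> height l + 1 \<and> height (avl_insert x r) \<le> height l + 1 \<and> height l \<le> height (avl_insert x r) + 1")
        (auto simp: max_def split: if_splits)
  qed (use 2 in auto)
qed auto

lemma avl_delete_max:
  "avl t \<Longrightarrow> avl (delete_max t) \<and> height (delete_max t) \<le> height t \<and>
     height t \<le> height (delete_max t) + 1"
proof (induction t rule: delete_max.induct)
  case (2 l a n r)
  then show ?case
    using avl_rebalance[of l "delete_max r" a] by (auto simp: max_def split: if_splits)
qed auto

lemma avl_delete:
  "avl t \<Longrightarrow> avl (avl_delete x t) \<and> height (avl_delete x t) \<le> height t \<and>
     height t \<le> height (avl_delete x t) + 1"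
proof (induction x t rule: avl_delete.induct)
  case (2 x l a n r)
  consider "x < a" | "a < x" | "x = a" by force
  then show ?case
  proof cases
    case 1
    with 2 avl_rebalance[of "avl_delete x l" r a] show ?thesis
      by (cases "height l \<le> height r + 1 \<and> height r \<le> height l + 1 \<and> height (avl_delete x l) \<le> height r + 1 \<and> height r \<le> height (avl_delete x l) + 1")
        (auto simp: max_def split: if_splits)
  next
    case b: 2
    with 2 avl_rebalance[of l "avl_delete x r" a] show ?thesis
      by (cases "height l \<le> height r + 1 \<and> height r \<le> height l + 1 \<and> height (avl_delete x r) \<le> height l + 1 \<and> height l \<le> height (avl_delete x r) + 1")
        (auto simp: max_def split: if_splits)
  next
    case 3
    with 2 avl_rebalance[of "delete_max l" r "max_key l"] avl_delete_max[of l] show ?thesis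
      by (auto simp: max_def split: if_splits)
  qed
qed auto

lemma avl_member: "search_tree t \<Longrightarrow> avl_member x t \<longleftrightarrow> x \<in> set (keys t)"
  by (induction x t rule: avl_member.induct)
     (force simp: search_tree_def sorted_wrt_append)+

lemma avl_insert_keys:
  "search_tree t \<Longrightarrow> search_tree (avl_insert x t) \<and> set (keys (avl_insert x t)) = insert x (set (keys t))"
  by (induction x t rule: avl_insert.induct)
     (auto simp: search_tree_def sorted_wrt_append)

lemma delete_max_keys: "t \<noteq> \<langle>\<rangle> \<Longrightarrow> keys t = keys (delete_max t) @ [max_key t]"
  by (induction t rule: delete_max.induct) auto

lemma min_key_keys: "t \<noteq> \<langle>\<rangle> \<Longrightarrow> min_key t = hd (keys t)"
  by (induction t rule: min_key.induct) auto

lemma min_key_Min: "search_tree t \<Longrightarrow> t \<noteq> \<langle>\<rangle> \<Longrightarrow> min_key t = Min (set (keys t))"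
  by (cases "keys t") (auto simp: search_tree_def min_key_keys intro!: Min_eqI[symmetric])

lemma max_key_Max: "search_tree t \<Longrightarrow> t \<noteq> \<langle>\<rangle> \<Longrightarrow> max_key t = Max (set (keys t))"
  using delete_max_keys[of t]
  by (auto simp: search_tree_def sorted_wrt_append intro!: Max_eqI[symmetric])

lemma avl_delete_keys:
  "search_tree t \<Longrightarrow> search_tree (avl_delete x t) \<and> set (keys (avl_delete x t)) = set (keys t) - {x}"
proof (induction x t rule: avl_delete.induct)
  case (2 x l a n r)
  consider "x < a" | "a < x" | "x = a" "l = \<langle>\<rangle>" | "x = a" "l \<noteq> \<langle>\<rangle>" by force
  then show ?case
  proof cases
    case 4
    then have "keys l = keys (delete_max l) @ [max_key l]" by (simp add: delete_max_keys)
    with 2(3) 4 show ?thesis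
      by (auto simp: search_tree_def sorted_wrt_append)
  qed (use 2 in \<open>force simp: search_tree_def sorted_wrt_append\<close>)+
qed (simp add: search_tree_def)

text \<open>The invariant of a buffer that does not mention the represented set.\<close>

definition buf_inv :: "nat \<Rightarrow> buffer \<Rightarrow> bool" where
  "buf_inv l b \<longleftrightarrow>
     search_tree (buf_tree b) \<and> avl (buf_tree b) \<and>
     buf_size b = card (buf_entries b) \<and> buf_size b \<le> l \<and>
     buf_min b = (if buf_entries b = {} then infinite_entry else Min (buf_entries b))"

lemma finite_buf_entries [simp]: "finite (buf_entries b)"
  by (simp add: buf_entries_def)

lemma buf_inv_empty: "buf_inv l empty_buffer"
  by (simp add: buf_inv_def empty_buffer_def buf_entries_def search_tree_def)

lemma smallest_all: "finite X \<Longrightarrow> card X \<le> r \<Longrightarrow> smallest X r = X"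
proof -
  assume a: "finite X" "card X \<le> r"
  have "card {q \<in> X. q < p} < card X" if "p \<in> X" for p
    using a that by (intro psubset_card_mono) auto
  with a show ?thesis by (fastforce simp: smallest_def)
qed

lemma card_smallest: "finite X \<Longrightarrow> card (smallest X r) = min r (card X)"
proof (induction "card X" arbitrary: X)
  case 0
  then show ?case by (simp add: smallest_def)
next
  case (Suc n)
  show ?case
  proof (cases "card X \<le> r")
    case True
    with Suc show ?thesis by (simp add: smallest_all)
  next
    case False
    define Y where "Y = X - {Max X}"
    have X: "X \<noteq> {}" using Suc.hyps(2) by auto
    have Y: "finite Y" "n = card Y" using Suc X by (auto simp: Y_def)
    have "smallest X r = smallest Y r"
    proof -
      have "{q \<in> X. q < Max X} = Y"
        using Suc.prems X by (auto simp: Y_def order.strict_iff_order)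
      then have "Max X \<notin> smallest X r" using False Y Suc.hyps(2) by (simp add: smallest_def)
      moreover have "{q \<in> X. q < p} = {q \<in> Y. q < p}" if "p \<in> X" for p
        using that leD[OF Max_ge[OF Suc.prems that]] by (auto simp: Y_def)
      ultimately show ?thesis by (auto simp: smallest_def Y_def)
    qed
    then show ?thesis using Suc.hyps(1)[OF Y(2,1)] False Suc.hyps(2) Y by simp
  qed
qed

lemma smallest_butmax:
  assumes "finite X" "card X = Suc r"
  shows "smallest X r = X - {Max X}"
proof -
  have ne: "X \<noteq> {}" using assms by auto
  have "{q \<in> X. q < Max X} = X - {Max X}" using assms ne
    by (auto simp: order.strict_iff_order)
  then have 1: "card {q \<in> X. q < Max X} = r" using assms ne by simp
  have 2: "card {q \<in> X. q < p} < r" if p: "p \<in> X" "p \<noteq> Max X" for p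
  proof -
    have "{q \<in> X. q < p} \<subset> X - {Max X}"
      using p assms by (auto dest: Max_ge leD)
    then have "card {q \<in> X. q < p} < card (X - {Max X})"
      using assms by (intro psubset_card_mono) auto
    also have "\<dots> = r" using assms ne by simp
    finally show ?thesis .
  qed
  show ?thesis using 1 2 by (auto simp: smallest_def)
qed

lemma buf_insert_correct:
  fixes p :: entry
  assumes "buf_inv l b" "0 < l"
  defines "X \<equiv> smallest (insert p (buf_entries b)) l"
  shows "buf_inv l (buf_insert l p b)"
    and "buf_entries (buf_insert l p b) = (if p \<le> buf_bound b then X else buf_entries b)"
    and "buf_bound (buf_insert l p b) =
           (if p \<le> buf_bound b \<and> card X = l then Max X else buf_bound b)"
proof -
  define t where "t = avl_insert p (buf_tree b)"
  define n where "n = (if avl_member p (buf_tree b) then buf_size b else buf_size b + 1)"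
  define t' where "t' = (if l < n then delete_max t else t)"
  have st: "search_tree t" "avl t" "set (keys t) = insert p (buf_entries b)"
    using assms avl_insert_keys avl_insert unfolding t_def buf_inv_def buf_entries_def by blast+
  have n: "n = card (set (keys t))" "n \<le> l + 1"
    using assms by (auto simp: n_def st buf_inv_def avl_member buf_entries_def insert_absorb)
  have t: "t \<noteq> \<langle>\<rangle>" using st(3) by auto
  have t': "search_tree t' \<and> avl t' \<and> set (keys t') = X"
  proof (cases "l < n")
    case True
    have k: "keys t = keys (delete_max t) @ [max_key t]" using t by (rule delete_max_keys)
    have s: "search_tree (delete_max t)" using st(1) k by (auto simp: search_tree_def sorted_wrt_append)
    have "set (keys (delete_max t)) = set (keys t) - {max_key t}"
      using st(1) k by (auto simp: search_tree_def sorted_wrt_append)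
    also have "\<dots> = X" unfolding X_def st(3)[symmetric]
      using True n st(1) t by (subst smallest_butmax) (auto simp: max_key_Max)
    finally show ?thesis using True s st(2) avl_delete_max[of t] by (auto simp: t'_def)
  next
    case False
    then have "card (set (keys t)) \<le> l" using n(1) by linarith
    then have "X = set (keys t)"
      unfolding X_def st(3)[symmetric] by (intro smallest_all) auto
    with False show ?thesis using st(1,2) by (simp add: t'_def)
  qed
  have "card X = min l (card (set (keys t)))"
    unfolding X_def st(3)[symmetric] by (rule card_smallest) simp
  then have c: "card X = (if l < n then n - 1 else n)"
    unfolding n(1)[symmetric] using n(2) by auto
  have "card X > 0"
  proof -
    have "n > 0" using n(1) t by (auto simp: card_gt_0_iff)
    then show ?thesis using assms(2) c by auto
  qed
  then have "t' \<noteq> \<langle>\<rangle>" using t' by auto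
  have eq: "buf_insert l p b =
    (if p \<le> buf_bound b then
       \<lparr>buf_tree = t', buf_size = card X, buf_min = Min X,
        buf_bound = if card X = l then Max X else buf_bound b\<rparr> else b)"
    unfolding c using t' \<open>t' \<noteq> \<langle>\<rangle>\<close>
    by (auto simp: buf_insert_def Let_def t_def[symmetric] n_def[symmetric] t'_def[symmetric]
          min_key_Min max_key_Max)
  show "buf_inv l (buf_insert l p b)"
    using assms(1) t' \<open>t' \<noteq> \<langle>\<rangle>\<close> n(2) c \<open>card X > 0\<close>
    by (auto simp: eq buf_inv_def buf_entries_def)
  show "buf_entries (buf_insert l p b) = (if p \<le> buf_bound b then X else buf_entries b)"
    using t' by (auto simp: eq buf_entries_def)
  show "buf_bound (buf_insert l p b) =
           (if p \<le> buf_bound b \<and> card X = l then Max X else buf_bound b)"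
    by (auto simp: eq)
qed

lemma buf_delete_correct:
  assumes "buf_inv l b"
  shows "buf_inv l (buf_delete p b)"
    and "buf_entries (buf_delete p b) = buf_entries b - {p}"
    and "buf_bound (buf_delete p b) = buf_bound b"
proof -
  have m: "avl_member p (buf_tree b) \<longleftrightarrow> p \<in> buf_entries b"
    using assms avl_member by (auto simp: buf_inv_def buf_entries_def)
  let ?t = "avl_delete p (buf_tree b)"
  have t: "search_tree ?t" "avl ?t" "set (keys ?t) = buf_entries b - {p}"
    using assms avl_delete_keys avl_delete unfolding buf_inv_def buf_entries_def by blast+
  have e: "?t = \<langle>\<rangle> \<longleftrightarrow> buf_entries b - {p} = {}"
    using t(3) keys_eq_Nil_iff[of ?t] set_empty by metis
  have mn: "?t \<noteq> \<langle>\<rangle> \<Longrightarrow> min_key ?t = Min (buf_entries b - {p})"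
    using t by (metis min_key_Min)
  show 2: "buf_entries (buf_delete p b) = buf_entries b - {p}"
    using m t(3) by (auto simp: buf_delete_def Let_def buf_entries_def)
  have "buf_inv l (buf_delete p b)" if "p \<in> buf_entries b"
  proof -
    have "buf_size b - 1 = card (buf_entries b - {p})" "buf_size b \<le> l"
      using assms that by (auto simp: buf_inv_def)
    then show ?thesis unfolding buf_inv_def 2
      using m t(1,2) e mn that by (auto simp: buf_delete_def Let_def)
  qed
  moreover have "buf_inv l (buf_delete p b)" if "p \<notin> buf_entries b"
    using assms m that by (auto simp: buf_delete_def)
  ultimately show "buf_inv l (buf_delete p b)" by blast
  show "buf_bound (buf_delete p b) = buf_bound b" by (simp add: buf_delete_def Let_def)
qed

lemma smallest_insert_below:
  assumes "finite X" "card (smallest X r) = r \<Longrightarrow> smallest X r \<noteq> {} \<Longrightarrow> p \<le> Max (smallest X r)"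
  shows "smallest (insert p (smallest X r)) r = smallest (insert p X) r"
proof (cases "card X \<le> r")
  case True
  then show ?thesis using assms by (simp add: smallest_all)
next
  case False
  have fin: "finite (smallest X r)" using assms(1) by (simp add: smallest_def)
  have c: "card (smallest X r) = r" using False assms(1) by (simp add: card_smallest)
  have sub: "smallest X r \<subseteq> X" by (auto simp: smallest_def)
  have down: "q \<in> smallest X r" if "q \<in> X" "q \<le> s" "s \<in> smallest X r" for q s
  proof -
    have "card {x \<in> X. x < q} \<le> card {x \<in> X. x < s}"
      using that assms(1) by (intro card_mono) auto
    with that show ?thesis by (auto simp: smallest_def)
  qed
  show ?thesis
  proof (intro equalityI subsetI)
    fix s assume s: "s \<in> smallest (insert p (smallest X r)) r"
    then have sX: "s \<in> insert p X" using sub by (auto simp: smallest_def)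
    have "r \<noteq> 0" using s by (auto simp: smallest_def)
    then have ne: "smallest X r \<noteq> {}" using c by auto
    have "s \<le> Max (smallest X r)"
      using s assms(2)[OF c ne] fin by (auto simp: smallest_def)
    then have "{q \<in> insert p X. q < s} = {q \<in> insert p (smallest X r). q < s}"
      using sub down[OF _ _ Max_in[OF fin ne]] by fastforce
    with s sX show "s \<in> smallest (insert p X) r" by (simp add: smallest_def)
  next
    fix s assume s: "s \<in> smallest (insert p X) r"
    have "card {q \<in> X. q < s} \<le> card {q \<in> insert p X. q < s}"
      using assms(1) by (intro card_mono) auto
    with s have "s \<in> insert p (smallest X r)" by (auto simp: smallest_def)
    moreover have "card {q \<in> insert p (smallest X r). q < s} \<le> card {q \<in> insert p X. q < s}"
      using assms(1) sub by (intro card_mono) auto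
    ultimately show "s \<in> smallest (insert p (smallest X r)) r"
      using s by (auto simp: smallest_def)
  qed
qed

lemma smallest_insert_above:
  assumes "finite X" "card (smallest X r) = r" "\<And>q. q \<in> smallest X r \<Longrightarrow> q < p"
  shows "smallest (insert p X) r = smallest X r"
proof -
  have fin: "finite (smallest X r)" using assms(1) by (simp add: smallest_def)
  have sub: "smallest X r \<subseteq> {q \<in> X. q < p}" using assms(3) by (auto simp: smallest_def)
  have "r \<le> card {q \<in> X. q < s}" if "p \<le> s" for s
    using card_mono[of "{q \<in> X. q < s}" "smallest X r"] assms(1,2) sub that by force
  then have ge: "s \<notin> smallest X r" "r \<le> card {q \<in> insert p X. q < s}" if "p \<le> s" for s
    using that card_mono[of "{q \<in> insert p X. q < s}" "{q \<in> X. q < s}"] assms(1)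
    by (fastforce simp: smallest_def)+
  have "{q \<in> insert p X. q < s} = {q \<in> X. q < s}" if "\<not> p \<le> s" for s
    using that by auto
  then show ?thesis using ge(2) ge(1) by (fastforce simp: smallest_def)
qed

text \<open>Initialisation yields the \<open>l\<close> smallest entries, and the largest of them as the threshold.\<close>

definition init_spec :: "nat \<Rightarrow> entry set \<Rightarrow> buffer \<Rightarrow> bool" where
  "init_spec l X b \<longleftrightarrow>
     buf_inv l b \<and> buf_entries b = smallest X l \<and>
     buf_bound b = (if card (smallest X l) = l then Max (smallest X l) else infinite_entry)"

lemma init_spec_insert:
  assumes "init_spec l X b" "finite X" "0 < l"
  shows "init_spec l (insert p X) (buf_insert l p b)"
proof -
  have inv: "buf_inv l b" and e: "buf_entries b = smallest X l"
    and bd: "buf_bound b = (if card (smallest X l) = l then Max (smallest X l) else infinite_entry)"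
    using assms(1) by (auto simp: init_spec_def)
  note ins = buf_insert_correct[OF inv \<open>0 < l\<close>, of p, unfolded e]
  have fin: "finite (smallest X l)" using assms(2) by (simp add: smallest_def)
  show ?thesis
  proof (cases "p \<le> buf_bound b")
    case True
    have 1: "smallest (insert p (smallest X l)) l = smallest (insert p X) l"
      using True bd assms(2) by (intro smallest_insert_below) auto
    have "card (smallest X l) \<le> card (smallest (insert p X) l)"
      using card_mono[of "insert p X" X, OF _ subset_insertI] assms(2) by (auto simp: card_smallest min_def)
    moreover have "card (smallest (insert p X) l) \<le> l" "card (smallest X l) \<le> l"
      using assms(2) by (auto simp: card_smallest)
    ultimately show ?thesis using True ins bd 1 by (auto simp: init_spec_def)
  next
    case False
    have inf: "q \<le> infinite_entry" for q :: entry by (auto simp: less_eq_entry_def)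
    with False bd have c: "card (smallest X l) = l" and p: "Max (smallest X l) < p"
      by (auto split: if_splits)
    have "smallest (insert p X) l = smallest X l"
      using assms(2) c p fin by (intro smallest_insert_above) (auto dest: Max_ge)
    then show ?thesis using False ins bd by (auto simp: init_spec_def)
  qed
qed

lemma sketch_init_correct:
  assumes "0 < l"
  shows "init_spec l (hash_pairs (set xs) (hs i)) (sketch_init l hs xs i)"
proof -
  have "init_spec l (hash_pairs (A \<union> set xs) (hs i)) (insert_all l hs xs S i)"
    if "finite A" "init_spec l (hash_pairs A (hs i)) (S i)" for A S
    using that
  proof (induction xs arbitrary: A S)
    case (Cons x xs)
    have "init_spec l (hash_pairs (insert x A) (hs i)) (sketch_insert l hs x S i)"
      using init_spec_insert[OF Cons.prems(2), of "entry_of (hs i) x"] Cons.prems(1) assms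
      by (simp add: sketch_insert_def hash_pairs_def)
    then show ?case using Cons.IH[of "insert x A"] Cons.prems(1) by simp
  qed simp
  moreover have "init_spec l (hash_pairs {} (hs i)) empty_buffer"
    using assms buf_inv_empty[of l]
    by (auto simp: init_spec_def hash_pairs_def smallest_def empty_buffer_def buf_entries_def)
  ultimately show ?thesis unfolding sketch_init_def by (metis finite.emptyI sup_bot_left)
qed

end

(*
  Fix a deletion from a set A and go back in time as long as the updates of this set number at most
  |A| / C. Let V be the union of the states of the set in this window. If the last initialisation lies
  in the window, a fault forces the l smallest entries of V to be absent from A. As |V - A| <= |V| / C,
  a union bound over the l-subsets of V - A and min-wise independence give this a probability of at
  most 2 C^(-l) per hash function, which is polynomially small in N of any prescribed degree if C is a
  large constant. If the last initialisation lies before the window, the updates since then pay for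
  the new one. The unlikely faults are handled by their expected cost and Markov's inequality, so that
  the length T of the stream does not enter.
*)
theory Submission
  imports Defs
begin

section \<open>Cost of the tree and buffer operations\<close>

text \<open>Min-wise independence speaks about sets fixed in advance, whereas the elements seen
  since the last initialisation depend on the hash functions through all earlier faults. The bridge
  is a one-sided property of thresholds, \<open>bound_covers\<close>: it can be stated for any
  \<open>V\<close> that contains those elements, so the random period may be replaced by a larger
  deterministic window. Deletions leave the threshold alone, and an insertion can only lower it to
  the largest of \<open>l\<close> entries of \<open>V\<close>, which is never below the
  \<open>l\<close> smallest ones. Early faults at different times are dependent, so only
  expectations are added: an early fault costs at most \<open>n\<close> insertions, hence the
  expected excess is at most \<open>T * n * k * 2 / C ^ l\<close>, against a budget of
  \<open>T\<close>. Tree operations are charged by the number of keys. Buffers have at most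
  \<open>l\<close> of them, and evaluating a hash function is already allowed time of order
  \<open>l\<close>, so this fits the claimed bound.\<close>

lemma T_avl_member_le: "T_avl_member x t \<le> size t + 1"
  by (induction x t rule: T_avl_member.induct) auto

lemma T_avl_insert_le: "T_avl_insert x t \<le> size t + 1"
  by (induction x t rule: T_avl_insert.induct) auto

lemma T_min_key_le: "T_min_key t \<le> size t + 1"
  by (induction t rule: T_min_key.induct) auto

lemma T_max_key_le: "T_max_key t \<le> size t + 1"
  by (induction t rule: T_max_key.induct) auto

lemma T_delete_max_le: "T_delete_max t \<le> size t + 1"
  by (induction t rule: T_delete_max.induct) auto

text \<open>The factor 2 accounts for deleting an inner key, where the left subtree is walked twice,
  by \<open>delete_max\<close> and by \<open>max_key\<close>.\<close>

lemma T_avl_delete_le: "T_avl_delete x t \<le> 2 * size t + 2"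
proof (induction x t rule: T_avl_delete.induct)
  case (2 x l a n r)
  then show ?case using T_delete_max_le[of l] T_max_key_le[of l] by auto
qed auto

lemma tree_words_eq: "tree_words t = 5 * size t"
  by (induction t rule: tree_words.induct) auto

lemma size_eq_card_keys:
  assumes "search_tree t"
  shows "size t = card (set (keys t))"
proof -
  have "distinct (keys t)"
    using assms by (simp add: search_tree_def strict_sorted_iff)
  moreover have "length (keys t) = size t" by (simp add: keys_def)
  ultimately show ?thesis using distinct_card by metis
qed

lemma buf_inv_size:
  assumes "buf_inv l b"
  shows "size (buf_tree b) = buf_size b" "size (buf_tree b) \<le> l"
  using assms size_eq_card_keys[of "buf_tree b"] by (auto simp: buf_inv_def buf_entries_def)

text \<open>There are at most five walks, each in a tree of at most \<open>l + 1\<close> keys: an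
  overfull tree holds one key too many before its maximum is removed.\<close>

lemma T_buf_insert_le:
  assumes "buf_inv l b"
  shows "T_buf_insert l p b \<le> 5 * l + 11"
proof -
  define t where "t = avl_insert p (buf_tree b)"
  define n where "n = (if avl_member p (buf_tree b) then buf_size b else buf_size b + 1)"
  define t' where "t' = (if l < n then delete_max t else t)"
  define n' where "n' = (if l < n then n - 1 else n)"
  have "search_tree t" "set (keys t) = insert p (set (keys (buf_tree b)))"
    using assms avl_insert_keys unfolding buf_inv_def t_def by blast+
  then have 1: "size t \<le> size (buf_tree b) + 1"
    using assms(1) by (auto simp: size_eq_card_keys buf_inv_def card_insert_if)
  have 2: "size (delete_max t) \<le> size t"
  proof (cases "t = \<langle>\<rangle>")
    case False
    from arg_cong[OF delete_max_keys[OF this], of length] show ?thesis by (simp add: keys_def)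
  qed simp
  have s: "size (buf_tree b) \<le> l" using assms by (rule buf_inv_size)
  have t': "size t' \<le> size t" using 2 by (simp add: t'_def)
  have "T_buf_insert l p b =
    (if p \<le> buf_bound b then
       T_avl_member p (buf_tree b) + T_avl_insert p (buf_tree b)
       + (if l < n then T_delete_max t else 0) + T_min_key t' + (if n' = l then T_max_key t' else 0)
     else 0) + 1"
    unfolding T_buf_insert_def Let_def t_def n_def t'_def n'_def ..
  also have "\<dots> \<le> T_avl_member p (buf_tree b) + T_avl_insert p (buf_tree b)
       + T_delete_max t + T_min_key t' + T_max_key t' + 1"
    by simp
  also have "\<dots> \<le> 5 * l + 11"
    using 1 s t' T_avl_member_le[of p "buf_tree b"] T_avl_insert_le[of p "buf_tree b"]
      T_delete_max_le[of t] T_min_key_le[of t'] T_max_key_le[of t']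
    by linarith
  finally show ?thesis .
qed

lemma T_buf_delete_le:
  assumes "buf_inv l b"
  shows "T_buf_delete p b \<le> 4 * l + 5"
proof -
  let ?t = "avl_delete p (buf_tree b)"
  have "search_tree ?t" "set (keys ?t) = set (keys (buf_tree b)) - {p}"
    using assms avl_delete_keys unfolding buf_inv_def by blast+
  then have 1: "size ?t \<le> size (buf_tree b)"
    using assms(1) by (auto simp: size_eq_card_keys buf_inv_def intro: card_mono)
  have s: "size (buf_tree b) \<le> l" using assms(1) by (rule buf_inv_size)
  show ?thesis
    using 1 s T_avl_member_le[of p "buf_tree b"] T_avl_delete_le[of p "buf_tree b"]
      T_min_key_le[of ?t]
    unfolding T_buf_delete_def Let_def by (simp del: T_avl_delete.simps)
qed

lemma buf_words_le: "buf_inv l b \<Longrightarrow> buf_words b \<le> 5 * l + 6"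
  using buf_inv_size(2)[of l b] by (simp add: buf_words_def tree_words_eq)

lemma T_read_signature_eq: "T_read_signature is S = length is + 1"
  by (induction "is") auto

text \<open>The final 2 covers the unit of \<open>T_sketch_insert\<close> and the unit that
  \<open>T_insert_all\<close> adds per element, so that an initialisation costs one
  \<open>op_cost\<close> per element apart from its fixed part.\<close>

definition op_cost :: "nat \<Rightarrow> nat \<Rightarrow> real \<Rightarrow> real" where
  "op_cost k l tb = real k * (tb + 5 * real l + 11) + 2"

lemma T_sketch_insert_le:
  assumes "\<And>i. i \<in> {1..k} \<Longrightarrow> buf_inv l (S i)" "\<And>i. i \<in> {1..k} \<Longrightarrow> real (\<tau> (hs i) x) \<le> tb"
  shows "real (T_sketch_insert k l \<tau> hs x S) + 1 \<le> op_cost k l tb"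
proof -
  have "(\<Sum>i=1..k. real (\<tau> (hs i) x) + real (T_buf_insert l (entry_of (hs i) x) (S i)))
      \<le> (\<Sum>i=1..k. tb + (5 * real l + 11))"
  proof (intro sum_mono add_mono)
    fix i assume "i \<in> {1..k}"
    from T_buf_insert_le[OF assms(1)[OF this], of "entry_of (hs i) x"]
    show "real (T_buf_insert l (entry_of (hs i) x) (S i)) \<le> 5 * real l + 11" by linarith
  qed (use assms(2) in auto)
  then show ?thesis by (simp add: T_sketch_insert_def op_cost_def algebra_simps)
qed

lemma T_insert_all_le:
  assumes "0 < l" "\<And>i. i \<in> {1..k} \<Longrightarrow> buf_inv l (S i)"
    "\<And>i x. i \<in> {1..k} \<Longrightarrow> x \<in> set xs \<Longrightarrow> real (\<tau> (hs i) x) \<le> tb"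
  shows "real (T_insert_all k l \<tau> hs xs S) \<le> real (length xs) * op_cost k l tb + 1"
  using assms(2,3)
proof (induction xs arbitrary: S)
  case (Cons x xs)
  have "buf_inv l (sketch_insert l hs x S i)" if "i \<in> {1..k}" for i
    using buf_insert_correct(1)[OF Cons.prems(1)[OF that] assms(1)] by (simp add: sketch_insert_def)
  then have "real (T_insert_all k l \<tau> hs xs (sketch_insert l hs x S))
      \<le> real (length xs) * op_cost k l tb + 1"
    using Cons.prems(2) by (intro Cons.IH) auto
  moreover have "real (T_sketch_insert k l \<tau> hs x S) + 1 \<le> op_cost k l tb"
    using Cons.prems by (intro T_sketch_insert_le) auto
  ultimately show ?case by (simp add: algebra_simps)
qed simp

text \<open>One \<open>op_cost\<close> covers the deletions from the buffers, a second one the fixed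
  part of an initialisation: creating \<open>k\<close> empty buffers and reaching the end of the
  stream.\<close>

lemma T_sketch_delete_le:
  assumes "0 < l" "0 \<le> tb" "\<And>i. i \<in> {1..k} \<Longrightarrow> buf_inv l (S i)"
    "\<And>i y. i \<in> {1..k} \<Longrightarrow> y \<in> insert x (set xs) \<Longrightarrow> real (\<tau> (hs i) y) \<le> tb"
  shows "real (T_sketch_delete k l \<tau> hs x xs S)
           \<le> 2 * op_cost k l tb + (if fault k hs x S then real (length xs) * op_cost k l tb else 0)"
proof -
  have "(\<Sum>i=1..k. real (\<tau> (hs i) x) + real (T_buf_delete (entry_of (hs i) x) (S i)))
      \<le> (\<Sum>i=1..k. tb + (5 * real l + 11))"
  proof (intro sum_mono add_mono)
    fix i assume "i \<in> {1..k}"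
    from T_buf_delete_le[OF assms(3)[OF this], of "entry_of (hs i) x"]
    show "real (T_buf_delete (entry_of (hs i) x) (S i)) \<le> 5 * real l + 11" by linarith
  qed (use assms(4) in auto)
  then have "(\<Sum>i=1..k. real (\<tau> (hs i) x) + real (T_buf_delete (entry_of (hs i) x) (S i))) + 1
      \<le> op_cost k l tb"
    by (simp add: op_cost_def algebra_simps)
  moreover have "real (T_insert_all k l \<tau> hs xs (\<lambda>i. empty_buffer))
      \<le> real (length xs) * op_cost k l tb + 1"
    using assms(1,4) buf_inv_empty by (intro T_insert_all_le) auto
  moreover have "real k + 1 \<le> op_cost k l tb"
  proof -
    have "real k * 1 \<le> real k * (tb + 5 * real l + 11)" using assms(2) by (intro mult_left_mono) auto
    then show ?thesis by (simp add: op_cost_def)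
  qed
  ultimately show ?thesis by (simp add: T_sketch_delete_def T_sketch_init_def)
qed

lemma sketch_words_le:
  assumes "\<And>i. i \<in> {1..k} \<Longrightarrow> buf_inv l (S i)"
  shows "sketch_words k S \<le> k * (5 * l + 6)"
proof -
  have "sketch_words k S \<le> (\<Sum>i=1..k. 5 * l + 6)"
    unfolding sketch_words_def using assms by (intro sum_mono buf_words_le)
  then show ?thesis by simp
qed

section \<open>Smallest entries\<close>

lemma le_infinite_entry [simp]: "p \<le> infinite_entry"
  by (cases "hval p") (auto simp: less_eq_entry_def)

lemma inj_entry_of: "inj (entry_of h)"
  by (simp add: inj_def)

lemma entry_of_mem_hash_pairs [simp]: "entry_of h x \<in> hash_pairs A h \<longleftrightarrow> x \<in> A"
  by (auto simp: hash_pairs_def)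

lemma finite_hash_pairs [simp]: "finite A \<Longrightarrow> finite (hash_pairs A h)"
  by (simp add: hash_pairs_def)

lemma card_hash_pairs [simp]: "card (hash_pairs A h) = card A"
  by (simp add: hash_pairs_def card_image inj_on_subset[OF inj_entry_of])

lemma hash_pairs_mono: "A \<subseteq> B \<Longrightarrow> hash_pairs A h \<subseteq> hash_pairs B h"
  by (auto simp: hash_pairs_def)

lemma hash_pairs_insert: "hash_pairs (insert x A) h = insert (entry_of h x) (hash_pairs A h)"
  by (simp add: hash_pairs_def)

lemma smallest_subset: "smallest X r \<subseteq> X"
  by (auto simp: smallest_def)

lemma smallest_downward:
  assumes "finite X" "q \<in> X" "q \<le> s" "s \<in> smallest X r"
  shows "q \<in> smallest X r"
proof -
  have "card {x \<in> X. x < q} \<le> card {x \<in> X. x < s}"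
    using assms by (intro card_mono) auto
  with assms show ?thesis by (auto simp: smallest_def)
qed

lemma smallest_iff_le_Max:
  assumes "finite X" "smallest X r \<noteq> {}" "p \<in> X"
  shows "p \<in> smallest X r \<longleftrightarrow> p \<le> Max (smallest X r)"
proof -
  have "finite (smallest X r)" using assms(1) smallest_subset by (rule rev_finite_subset)
  from Max_ge[OF this] Max_in[OF this assms(2)] smallest_downward[OF assms(1,3)]
  show ?thesis by blast
qed

text \<open>Were \<open>p\<close> above \<open>Max Z\<close>, all \<open>r\<close> members of
  \<open>Z\<close> would be counted below \<open>p\<close>. This keeps thresholds from falling too
  low, since a lowered threshold is the maximum of \<open>l\<close> entries.\<close>

lemma smallest_le_Max:
  assumes "finite X" "Z \<subseteq> X" "card Z = r" "p \<in> smallest X r"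
  shows "p \<le> Max Z"
proof (rule ccontr)
  assume "\<not> p \<le> Max Z"
  moreover have "finite Z" using assms(1,2) by (rule rev_finite_subset)
  ultimately have "q < p" if "q \<in> Z" for q
    using Max_ge[OF _ that] by (meson le_less_trans not_le)
  then have "Z \<subseteq> {q \<in> X. q < p}" using assms(2) by blast
  then have "r \<le> card {q \<in> X. q < p}"
    using assms(1,3) card_mono[of "{q \<in> X. q < p}" Z] by simp
  then show False using assms(4) by (simp add: smallest_def)
qed

section \<open>Invariants of a single buffer\<close>

lemma buffered_minhash_init:
  assumes "init_spec l (hash_pairs A h) b" "0 < l" "A \<subseteq> {1..N}" "h \<in> {1..N} \<rightarrow> {1..N}"
  shows "buffered_minhash N l h A b"
proof -
  let ?X = "hash_pairs A h"
  have fin: "finite A" using assms(3) finite_subset by blast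
  have inv: "buf_inv l b" and e: "buf_entries b = smallest ?X l"
    and bd: "buf_bound b = (if card (smallest ?X l) = l then Max (smallest ?X l) else infinite_entry)"
    using assms(1) by (auto simp: init_spec_def)
  have c: "card (smallest ?X l) = min l (card A)" using fin by (simp add: card_smallest)
  have fs: "finite (smallest ?X l)" using e finite_buf_entries by metis
  have ne: "smallest ?X l = {} \<longleftrightarrow> A = {}"
    using c fs fin assms(2) by (metis card_gt_0_iff min_less_iff_conj)
  have bound: "buf_bound b \<in> insert infinite_entry ?X"
  proof (cases "card (smallest ?X l) = l")
    case True
    then have "smallest ?X l \<noteq> {}" using assms(2) by auto
    then have "Max (smallest ?X l) \<in> ?X" using Max_in[OF fs] smallest_subset by blast
    with True bd show ?thesis by simp
  qed (simp add: bd)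
  have "entry_of h x \<in> smallest ?X l \<longleftrightarrow> entry_of h x \<le> buf_bound b" if "x \<in> A" for x
  proof (cases "card (smallest ?X l) = l")
    case True
    have "smallest ?X l \<noteq> {}" using ne that by blast
    from smallest_iff_le_Max[OF _ this, of "entry_of h x"] show ?thesis
      using True bd fin that by simp
  next
    case False
    then have "smallest ?X l = ?X" using c fin by (intro smallest_all) auto
    then show ?thesis using that bd False by simp
  qed
  moreover have "hval (buf_bound b) \<in> insert \<infinity> (enat ` {1..N})"
      "elt (buf_bound b) \<in> insert \<infinity> (enat ` {1..N})"
    using bound assms(3,4) by (auto simp: hash_pairs_def Pi_iff simp del: atLeastAtMost_iff)
  moreover have "A = {} \<Longrightarrow> buf_bound b = infinite_entry" using bound by (auto simp: hash_pairs_def)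
  ultimately show ?thesis
    using inv e ne c by (auto simp: buffered_minhash_def buf_inv_def smallest_def)
qed

lemma buffered_minhash_insert:
  assumes "buf_inv l b" "0 < l" "buffered_minhash N l h A b" "x \<in> {1..N}" "h \<in> {1..N} \<rightarrow> {1..N}"
    "A \<subseteq> {1..N}"
  shows "buffered_minhash N l h (insert x A) (buf_insert l (entry_of h x) b)"
proof -
  define p where "p = entry_of h x"
  define b' where "b' = buf_insert l p b"
  define X where "X = smallest (insert p (buf_entries b)) l"
  note ins = buf_insert_correct[OF assms(1,2), of p, folded b'_def X_def]
  have mem: "\<And>y. y \<in> A \<Longrightarrow> entry_of h y \<in> buf_entries b \<longleftrightarrow> entry_of h y \<le> buf_bound b"
    and sub: "buf_entries b \<subseteq> hash_pairs A h" and ne: "buf_entries b = {} \<longleftrightarrow> A = {}"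
    and emp: "A = {} \<Longrightarrow> buf_bound b = infinite_entry"
    using assms(3) by (auto simp: buffered_minhash_def)
  have "buffered_minhash N l h (insert x A) b'"
  proof (cases "p \<le> buf_bound b")
    case False
    \<comment> \<open>An empty set has an infinite threshold, which no entry exceeds.\<close>
    then have "A \<noteq> {}" using emp by auto
    moreover have "p \<notin> buf_entries b" using False sub mem by (auto simp: hash_pairs_def p_def)
    ultimately show ?thesis using assms(3) False ins
      by (auto simp: buffered_minhash_def b'_def buf_insert_def hash_pairs_insert p_def)
  next
    case True
    have e: "buf_entries b' = X" and i: "buf_inv l b'" using ins True by auto
    have bd: "buf_bound b' = (if card X = l then Max X else buf_bound b)" using ins True by simp
    have c: "card X = min l (card (insert p (buf_entries b)))" by (simp add: card_smallest X_def)
    have "card (insert p (buf_entries b)) \<noteq> 0" by simp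
    then have "card X \<noteq> 0" using c assms(2) by linarith
    then have Xne: "X \<noteq> {}" by auto
    have fX: "finite X" using e finite_buf_entries by metis
    have Xsub: "X \<subseteq> hash_pairs (insert x A) h"
      using sub smallest_subset[of "insert p (buf_entries b)" l] by (auto simp: hash_pairs_insert p_def X_def)
    have ins_mem: "entry_of h y \<in> insert p (buf_entries b) \<longleftrightarrow> entry_of h y \<le> buf_bound b"
      if "y \<in> insert x A" for y
      using that mem True by (auto simp: p_def)
    have M: "Max X \<in> X" using fX Xne by (rule Max_in)
    then obtain z where z: "z \<in> insert x A" "Max X = entry_of h z"
      using Xsub unfolding hash_pairs_def by blast
    \<comment> \<open>The new threshold is an entry that passed the old one, so it is no larger, and
      every entry of the new set below it was already buffered or is \<open>p\<close>.\<close>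
    have "Max X \<in> insert p (buf_entries b)" using M smallest_subset unfolding X_def by blast
    then have Mle: "Max X \<le> buf_bound b" using ins_mem[OF z(1)] unfolding z(2) by simp
    have "entry_of h y \<in> X \<longleftrightarrow> entry_of h y \<le> buf_bound b'" if y: "y \<in> insert x A" for y
    proof (cases "card X = l")
      case True
      show ?thesis
      proof
        assume "entry_of h y \<in> X"
        from Max_ge[OF fX this] show "entry_of h y \<le> buf_bound b'" using True bd by simp
      next
        assume "entry_of h y \<le> buf_bound b'"
        then have le: "entry_of h y \<le> Max X" using True bd by simp
        then have "entry_of h y \<in> insert p (buf_entries b)"
          using ins_mem[OF y] Mle by (meson order_trans)
        from smallest_downward[OF _ this le, of l] M show "entry_of h y \<in> X"
          by (simp add: X_def)
      qed
    next
      case False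
      then have "X = insert p (buf_entries b)" using c unfolding X_def by (intro smallest_all) auto
      then show ?thesis using False bd ins_mem[OF y] by simp
    qed
    moreover have "hval (buf_bound b') \<in> insert \<infinity> (enat ` {1..N}) \<and>
        elt (buf_bound b') \<in> insert \<infinity> (enat ` {1..N})"
    proof (cases "card X = l")
      case True
      then show ?thesis using bd z assms(4-6) by auto
    next
      case False
      then show ?thesis using assms(3) bd by (simp add: buffered_minhash_def)
    qed
    ultimately show ?thesis
      using e i Xne Xsub c unfolding buffered_minhash_def buf_inv_def by simp
  qed
  then show ?thesis by (simp add: b'_def p_def)
qed

text \<open>The old threshold stays valid because removing an element creates no new entry below it.
  The last assumption expresses that no fault occurs.\<close>

lemma buffered_minhash_delete:
  assumes "buffered_minhash N l h A b" "buf_inv l b"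
    "buf_entries b \<noteq> {} \<Longrightarrow> buf_entries b - {entry_of h x} \<noteq> {}"
  shows "buffered_minhash N l h (A - {x}) (buf_delete (entry_of h x) b)"
proof -
  note del = buf_delete_correct[OF assms(2), of "entry_of h x"]
  have "card (buf_entries b - {entry_of h x}) \<le> card (buf_entries b)"
    by (intro card_mono) auto
  moreover have "buf_entries b - {entry_of h x} \<subseteq> hash_pairs (A - {x}) h"
    using assms(1) by (auto simp: buffered_minhash_def hash_pairs_def)
  moreover have "buf_entries b - {entry_of h x} = {} \<longleftrightarrow> A - {x} = {}"
    using assms(1,3) calculation(2) by (auto simp: buffered_minhash_def hash_pairs_def)
  \<comment> \<open>A deletion that makes the set empty is always a fault, so the threshold never
    has to be reset to infinity here.\<close>
  moreover have "A - {x} = {} \<Longrightarrow> A = {}"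
    using calculation(3) assms(1,3) by (auto simp: buffered_minhash_def)
  moreover have "search_tree (buf_tree (buf_delete (entry_of h x) b))"
      "avl (buf_tree (buf_delete (entry_of h x) b))"
    using del(1) by (auto simp: buf_inv_def)
  ultimately show ?thesis
    using assms(1) unfolding buffered_minhash_def del(2,3) by auto
qed

text \<open>Entries outside the buffer lie above the threshold and buffered ones do not, so the
  lexicographic minimum of the buffer is that of the whole set, and its first component is the
  minimal hash value.\<close>

lemma hval_buf_min:
  assumes "buffered_minhash N l h A b" "buf_inv l b" "finite A"
  shows "hval (buf_min b) = minhash h A"
proof (cases "A = {}")
  case True
  then show ?thesis using assms by (auto simp: buffered_minhash_def buf_inv_def minhash_def)
next
  case False
  let ?B = "buf_entries b"
  have ne: "?B \<noteq> {}" and sub: "?B \<subseteq> hash_pairs A h"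
    and mem: "\<And>x. x \<in> A \<Longrightarrow> entry_of h x \<in> ?B \<longleftrightarrow> entry_of h x \<le> buf_bound b"
    using False assms(1) by (auto simp: buffered_minhash_def)
  have M: "Min ?B \<in> ?B" using ne by (intro Min_in) auto
  then obtain z where z: "z \<in> A" "Min ?B = entry_of h z" using sub by (auto simp: hash_pairs_def)
  have le: "entry_of h z \<le> entry_of h y" if y: "y \<in> A" for y
  proof (cases "entry_of h y \<in> ?B")
    case True
    then show ?thesis using Min_le[of ?B "entry_of h y"] z by simp
  next
    case False
    then have "buf_bound b < entry_of h y" using mem[OF y] by simp
    moreover have "entry_of h z \<le> buf_bound b" using mem[OF z(1)] M z(2) by simp
    ultimately show ?thesis by simp
  qed
  then have "h z \<le> h y" if "y \<in> A" for y using that by (fastforce simp: less_eq_entry_def)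
  then have "Min (h ` A) = h z" using z(1) assms(3) by (intro Min_eqI) auto
  then show ?thesis using False z(2) ne assms(2) by (simp add: minhash_def buf_inv_def)
qed

text \<open>A lower bound on the threshold alone, without reference to the current set, so that a
  single \<open>V\<close> can serve for a whole period of updates.\<close>

definition bound_covers :: "nat \<Rightarrow> (nat \<Rightarrow> nat) \<Rightarrow> nat set \<Rightarrow> buffer \<Rightarrow> bool" where
  "bound_covers l h V b \<longleftrightarrow> (\<forall>p \<in> smallest (hash_pairs V h) l. p \<le> buf_bound b)"

lemma bound_covers_init:
  assumes "init_spec l (hash_pairs A h) b" "A \<subseteq> V" "finite V"
  shows "bound_covers l h V b"
proof -
  have "smallest (hash_pairs A h) l \<subseteq> hash_pairs V h"
    using smallest_subset hash_pairs_mono[OF assms(2)] by (rule subset_trans)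
  then show ?thesis
    using assms(1,3) smallest_le_Max[of "hash_pairs V h" "smallest (hash_pairs A h) l" l]
    by (auto simp: bound_covers_def init_spec_def)
qed

text \<open>If the threshold changes, it becomes the maximum of \<open>l\<close> entries of
  \<open>V\<close>, to which \<open>smallest_le_Max\<close> applies.\<close>

lemma bound_covers_insert:
  assumes "bound_covers l h V b" "buf_inv l b" "0 < l" "finite V"
    "buf_entries b \<subseteq> hash_pairs V h" "x \<in> V"
  shows "bound_covers l h V (buf_insert l (entry_of h x) b)"
proof -
  let ?X = "smallest (insert (entry_of h x) (buf_entries b)) l"
  have "?X \<subseteq> hash_pairs V h"
    using smallest_subset[of "insert (entry_of h x) (buf_entries b)" l] assms(5,6) by auto
  then show ?thesis
    using assms(1,4) smallest_le_Max[of "hash_pairs V h" ?X l]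
      buf_insert_correct(3)[OF assms(2,3), of "entry_of h x"]
    by (auto simp: bound_covers_def)
qed

lemma bound_covers_delete:
  assumes "bound_covers l h V b" "buf_inv l b"
  shows "bound_covers l h V (buf_delete p b)"
  using assms by (simp add: bound_covers_def buf_delete_correct(3))

section \<open>The smallest entries are unlikely to lie in a small subset\<close>

text \<open>The binomials are compared factor by factor: \<open>C * (d - i) \<le> v - i\<close>,
  because \<open>C * d \<le> v\<close> and \<open>i \<le> C * i\<close>.\<close>

lemma binomial_ratio_le:
  fixes C :: real
  assumes "1 \<le> C" "C * real d \<le> real v"
  shows "real (d choose l) * C ^ l \<le> real (v choose l)"
proof (cases "l \<le> d")
  case True
  have "real d \<le> C * real d" using assms(1) by (simp add: mult_le_cancel_right1)
  then have dv: "d \<le> v" using assms(2) by linarith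
  have "real (d choose l) * C ^ l = (\<Prod>i = 0..<l. (real (d - i) / real (l - i)) * C)"
    by (simp only: binomial_altdef_of_nat[OF True] prod.distrib prod_constant
        card_atLeastLessThan diff_zero)
  also have "\<dots> \<le> (\<Prod>i = 0..<l. real (v - i) / real (l - i))"
  proof (rule prod_mono)
    fix i assume i: "i \<in> {0..<l}"
    have "real (d - i) * C \<le> real (v - i)"
    proof -
      have "real i \<le> C * real i" using assms(1) by (simp add: mult_le_cancel_right1)
      then show ?thesis using assms(2) i True dv by (simp add: of_nat_diff algebra_simps)
    qed
    then show "0 \<le> real (d - i) / real (l - i) * C \<and>
        real (d - i) / real (l - i) * C \<le> real (v - i) / real (l - i)"
      using assms(1) i by (simp add: divide_right_mono)
  qed
  also have "\<dots> = real (v choose l)" using True dv by (simp add: binomial_altdef_of_nat)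
  finally show ?thesis .
qed (simp add: binomial_eq_0)

lemma prob_smallest_avoids:
  fixes C :: real
  assumes fam: "min_wise_family N \<epsilon> d \<H>" and V: "V \<subseteq> {1..N}" "V \<noteq> {}" and C: "1 < C"
    and small: "C * real (card (V - A)) \<le> real (card V)"
  shows "measure_pmf.prob (pmf_of_set \<H>) {h. smallest (hash_pairs V h) d \<inter> hash_pairs A h = {}}
           \<le> 2 / C ^ d"
proof -
  let ?D = "V - A"
  let ?I = "{X. X \<subseteq> ?D \<and> card X = d}"
  let ?G = "\<lambda>X. {h. V - X = {} \<or> Max (h ` X) \<le> Min (h ` (V - X))}"
  have fin: "finite V" using V(1) finite_subset by blast
  have d: "2 \<le> d" "\<epsilon> < 1" using fam by (auto simp: min_wise_family_def)
  have "{h. smallest (hash_pairs V h) d \<inter> hash_pairs A h = {}} \<subseteq> (\<Union>X\<in>?I. ?G X)"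
  proof
    fix h assume "h \<in> {h. smallest (hash_pairs V h) d \<inter> hash_pairs A h = {}}"
    then have disj: "smallest (hash_pairs V h) d \<inter> hash_pairs A h = {}" by simp
    define Y where "Y = smallest (hash_pairs V h) d"
    define X where "X = {x \<in> V. entry_of h x \<in> Y}"
    have "Y = hash_pairs X h"
      using smallest_subset[of "hash_pairs V h" d] by (auto simp: Y_def X_def hash_pairs_def)
    then have "card X = card Y" by simp
    then have c: "card X = min d (card V)" using fin by (simp add: Y_def card_smallest)
    have "x \<notin> A" if "x \<in> X" for x
      using that disj entry_of_mem_hash_pairs[of h x A] by (auto simp: X_def Y_def)
    then have XD: "X \<subseteq> ?D" by (auto simp: X_def)
    \<comment> \<open>Otherwise \<open>X\<close> would be all of \<open>V\<close>, so
      \<open>V\<close> would avoid \<open>A\<close>, and \<open>small\<close> with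
      \<open>1 < C\<close> would force \<open>V\<close> to be empty.\<close>
    have "card X = d"
    proof (rule ccontr)
      assume "card X \<noteq> d"
      then have "card V \<le> card ?D" using c XD card_mono[of ?D X] fin by (simp add: min_def split: if_splits)
      then have "C * real (card V) \<le> real (card V)"
        using small C by (smt (verit) mult_left_mono of_nat_le_iff)
      moreover have "0 < real (card V)" using fin V(2) by (simp add: card_gt_0_iff)
      ultimately show False using C by simp
    qed
    moreover have "h \<in> ?G X"
    proof -
      have fX: "finite X" using fin by (simp add: X_def)
      have "X \<noteq> {}" using \<open>card X = d\<close> d by auto
      \<comment> \<open>Ties between hash values are broken by the element, so only the weak
        inequality follows; it is the one that the min-wise event asks for.\<close>
      have "h x \<le> h y" if x: "x \<in> X" and y: "y \<in> V - X" for x y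
      proof (rule ccontr)
        assume "\<not> h x \<le> h y"
        then have "entry_of h y \<le> entry_of h x" by (simp add: less_eq_entry_def)
        moreover have "entry_of h x \<in> Y" using x by (simp add: X_def)
        ultimately have "entry_of h y \<in> Y"
          using smallest_downward[of "hash_pairs V h" "entry_of h y" "entry_of h x" d] fin y
          by (simp add: Y_def)
        then show False using y by (simp add: X_def)
      qed
      then have "Max (h ` X) \<le> Min (h ` (V - X))" if "V - X \<noteq> {}"
        using that fX fin \<open>X \<noteq> {}\<close> by (intro Max.boundedI Min.boundedI) auto
      then show ?thesis by blast
    qed
    ultimately show "h \<in> (\<Union>X\<in>?I. ?G X)" using XD by blast
  qed
  then have "measure_pmf.prob (pmf_of_set \<H>) {h. smallest (hash_pairs V h) d \<inter> hash_pairs A h = {}}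
      \<le> measure_pmf.prob (pmf_of_set \<H>) (\<Union>X\<in>?I. ?G X)"
    by (intro measure_pmf.finite_measure_mono) auto
  also have "\<dots> \<le> (\<Sum>X\<in>?I. measure_pmf.prob (pmf_of_set \<H>) (?G X))"
    using fin by (intro measure_UNION_le) auto
  also have "\<dots> \<le> (\<Sum>X\<in>?I. (1 + \<epsilon>) / real (card V choose d))"
  proof (rule sum_mono)
    fix X assume "X \<in> ?I"
    then have X: "X \<subseteq> V" "card X = d" by auto
    with fam V(1) have "measure_pmf.prob (pmf_of_set \<H>) (?G X)
        \<in> {(1 - \<epsilon>) / real (card V choose card X) .. (1 + \<epsilon>) / real (card V choose card X)}"
      unfolding min_wise_family_def by blast
    with X(2) show "measure_pmf.prob (pmf_of_set \<H>) (?G X) \<le> (1 + \<epsilon>) / real (card V choose d)"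
      by simp
  qed
  also have "\<dots> = real (card ?D choose d) * ((1 + \<epsilon>) / real (card V choose d))"
    using fin by (simp add: n_subsets)
  also have "\<dots> \<le> real (card ?D choose d) * (2 / real (card V choose d))"
    using d by (intro mult_left_mono divide_right_mono) auto
  also have "\<dots> \<le> 2 / C ^ d"
  proof (cases "card V choose d = 0")
    case False
    then show ?thesis
      using binomial_ratio_le[of C "card ?D" "card V" d] C small by (simp add: field_simps)
  next
    \<comment> \<open>Here \<open>V\<close> has fewer than \<open>d\<close> elements, and division
      by zero yields 0.\<close>
    case True
    then have e: "2 / real (card V choose d) = 0" by simp
    show ?thesis unfolding e using C by simp
  qed
  finally show ?thesis .
qed

lemma prob_Pi_pmf_ex_le:
  assumes "measure_pmf.prob p E \<le> r"
  shows "measure_pmf.prob (Pi_pmf {1..k} dflt (\<lambda>_. p)) {f. \<exists>i\<in>{1..k}. f i \<in> E} \<le> real k * r"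
proof -
  let ?P = "Pi_pmf {1..k} dflt (\<lambda>_. p)"
  have "measure_pmf.prob ?P {f. \<exists>i\<in>{1..k}. f i \<in> E}
      = measure_pmf.prob ?P (\<Union>i\<in>{1..k}. {f. f i \<in> E})"
    by (intro arg_cong2[where f = measure]) auto
  also have "\<dots> \<le> (\<Sum>i\<in>{1..k}. measure_pmf.prob ?P {f. f i \<in> E})"
    by (intro measure_UNION_le) auto
  also have "\<dots> \<le> (\<Sum>i\<in>{1..k}. r)"
  proof (rule sum_mono)
    fix i assume "i \<in> {1..k}"
    then have "map_pmf (\<lambda>f. f i) ?P = p" by (subst Pi_pmf_component) auto
    then have "measure_pmf.prob p E = measure_pmf.prob ?P ((\<lambda>f. f i) -` E)"
      by (metis measure_map_pmf)
    then show "measure_pmf.prob ?P {f. f i \<in> E} \<le> r" using assms by (simp add: vimage_def)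
  qed
  also have "\<dots> = real k * r" by simp
  finally show ?thesis .
qed

section \<open>Streams of updates\<close>

primrec target :: "update \<Rightarrow> nat" where
  "target (Insert j x) = j"
| "target (Delete j x) = j"

primrec element :: "update \<Rightarrow> nat" where
  "element (Insert j x) = x"
| "element (Delete j x) = x"

lemma apply_update_other: "j \<noteq> target u \<Longrightarrow> apply_update u D j = D j"
  by (cases u) auto

lemma update_sketches_other: "j \<noteq> target u \<Longrightarrow> update_sketches k l hs q C u D j = D j"
  by (cases u) auto

text \<open>Initial sets, updates and query answers are fixed, while the hash functions remain an
  argument of whatever depends on them: they are the random variable, drawn independently of the
  stream.\<close>

locale sketch_stream =
  fixes N k l m :: nat and A\<^sub>0 :: "nat \<Rightarrow> nat set" and us :: "nat \<Rightarrow> update" and T :: nat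
    and query :: "nat \<Rightarrow> nat set \<Rightarrow> nat list"
  assumes l_pos: "0 < l"
    and A\<^sub>0: "\<And>j. j \<in> {1..m} \<Longrightarrow> A\<^sub>0 j \<subseteq> {1..N}"
    and valid: "\<And>t. t < T \<Longrightarrow> valid_update N m (us t)"
    and query: "valid_query N query"
begin

abbreviation A :: "nat \<Rightarrow> nat \<Rightarrow> nat set" where
  "A \<equiv> sets_at A\<^sub>0 us"

abbreviation S :: "hashes \<Rightarrow> nat \<Rightarrow> nat \<Rightarrow> sketch" where
  "S hs \<equiv> sketches_at k l hs query A\<^sub>0 us"

abbreviation J :: "nat \<Rightarrow> nat" where
  "J t \<equiv> target (us t)"

definition hashes_ok :: "hashes \<Rightarrow> bool" where
  "hashes_ok hs \<longleftrightarrow> (\<forall>i\<in>{1..k}. hs i \<in> {1..N} \<rightarrow> {1..N})"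

definition faulty :: "hashes \<Rightarrow> nat \<Rightarrow> bool" where
  "faulty hs t \<longleftrightarrow>
     (\<exists>x. us t = Delete (J t) x \<and> fault k hs x (S hs t (J t)))"

primrec last_init :: "hashes \<Rightarrow> nat \<Rightarrow> nat \<Rightarrow> nat" where
  "last_init hs 0 j = 0"
| "last_init hs (Suc t) j = (if j = J t \<and> faulty hs t then Suc t else last_init hs t j)"

text \<open>Updates without effect count too: they are operations and help to pay for the next
  initialisation.\<close>

definition touches :: "nat \<Rightarrow> nat \<Rightarrow> nat \<Rightarrow> nat" where
  "touches s t j = card {r \<in> {s..<t}. J r = j}"

section \<open>Invariants of the sketches along the stream\<close>

lemma target_in: "t < T \<Longrightarrow> J t \<in> {1..m}"
  using valid[of t] by (cases "us t") auto

lemma element_in: "t < T \<Longrightarrow> element (us t) \<in> {1..N}"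
  using valid[of t] by (cases "us t") auto

lemma A_subset: "t \<le> T \<Longrightarrow> j \<in> {1..m} \<Longrightarrow> A t j \<subseteq> {1..N}"
proof (induction t arbitrary: j)
  case (Suc t)
  then have "A t j \<subseteq> {1..N}" "element (us t) \<in> {1..N}" using element_in by auto
  then show ?case by (cases "us t") auto
qed (use A\<^sub>0 in auto)

lemma finite_A: "t \<le> T \<Longrightarrow> j \<in> {1..m} \<Longrightarrow> finite (A t j)"
  using A_subset finite_subset by blast

lemma query_set: "X \<subseteq> {1..N} \<Longrightarrow> set (query t X) = X" "X \<subseteq> {1..N} \<Longrightarrow> distinct (query t X)"
  using query by (auto simp: valid_query_def)

text \<open>The common case distinction of the inductions over time. In the last case the old sketch
  is forgotten and only the specification of an initialisation remains.\<close>

lemma sketch_step_cases: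
  assumes "t < T" "j \<in> {1..m}"
  obtains
    (other) "j \<noteq> J t" "A (Suc t) j = A t j" "S hs (Suc t) j = S hs t j"
      "last_init hs (Suc t) j = last_init hs t j"
  | (insert) x where "j = J t" "us t = Insert j x" "x \<in> {1..N}" "A (Suc t) j = insert x (A t j)"
      "\<And>i. S hs (Suc t) j i = buf_insert l (entry_of (hs i) x) (S hs t j i)"
      "last_init hs (Suc t) j = last_init hs t j"
  | (delete) x where "j = J t" "us t = Delete j x" "\<not> fault k hs x (S hs t j)"
      "A (Suc t) j = A t j - {x}"
      "\<And>i. S hs (Suc t) j i = buf_delete (entry_of (hs i) x) (S hs t j i)"
      "last_init hs (Suc t) j = last_init hs t j"
  | (init) x where "j = J t" "us t = Delete j x" "fault k hs x (S hs t j)"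
      "A (Suc t) j = A t j - {x}"
      "\<And>i. init_spec l (hash_pairs (A (Suc t) j) (hs i)) (S hs (Suc t) j i)"
      "last_init hs (Suc t) j = Suc t"
proof (cases "j = J t")
  case False
  then show ?thesis using other by (simp add: apply_update_other update_sketches_other)
next
  case True
  show ?thesis
  proof (cases "us t")
    case (Insert j' x)
    then show ?thesis
      using insert[of x] True element_in[OF assms(1)] by (simp add: sketch_insert_def faulty_def)
  next
    case (Delete j' x)
    show ?thesis
    proof (cases "fault k hs x (S hs t j)")
      case f: True
      have "A t j - {x} \<subseteq> {1..N}" using A_subset[of t j] assms by auto
      then have "init_spec l (hash_pairs (A (Suc t) j) (hs i)) (S hs (Suc t) j i)" for i
        using f True Delete sketch_init_correct[OF l_pos, of "query (Suc t) (A t j - {x})" hs i]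
        by (simp add: sketch_delete_def query_set)
      then show ?thesis using init[of x] f True Delete by (simp add: faulty_def)
    next
      case f: False
      then show ?thesis using delete[of x] True Delete
        by (simp add: sketch_delete_def sketch_remove_def faulty_def)
    qed
  qed
qed

lemma no_fault_nonempty:
  assumes "\<not> fault k hs x S'" "i \<in> {1..k}" "buf_inv l (S' i)" "buf_entries (S' i) \<noteq> {}"
  shows "buf_entries (S' i) - {entry_of (hs i) x} \<noteq> {}"
proof -
  have "buf_size (S' i) \<noteq> 0" using assms(3,4) by (simp add: buf_inv_def)
  then have "buf_size (buf_delete (entry_of (hs i) x) (S' i)) \<noteq> 0"
    using assms(1,2) bexI[of _ i "{1..k}"] unfolding fault_def sketch_remove_def
    by (metis (no_types, lifting))
  moreover have "buf_size (buf_delete (entry_of (hs i) x) (S' i))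
      = card (buf_entries (S' i) - {entry_of (hs i) x})"
    using buf_delete_correct(1,2)[OF assms(3), of "entry_of (hs i) x"] by (simp add: buf_inv_def)
  ultimately show ?thesis by (metis card.empty)
qed

lemma sketch_invariant:
  assumes "hashes_ok hs" "i \<in> {1..k}" "t \<le> T" "j \<in> {1..m}"
  shows "buf_inv l (S hs t j i) \<and> buffered_minhash N l (hs i) (A t j) (S hs t j i)"
  using assms(3,4)
proof (induction t arbitrary: j)
  case 0
  have "init_spec l (hash_pairs (A\<^sub>0 j) (hs i)) (sketch_init l hs (query 0 (A\<^sub>0 j)) i)"
    using sketch_init_correct[OF l_pos, of "query 0 (A\<^sub>0 j)" hs i] 0 A\<^sub>0 by (simp add: query_set)
  moreover have "hs i \<in> {1..N} \<rightarrow> {1..N}" using assms(1,2) by (simp add: hashes_ok_def)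
  ultimately show ?case
    using buffered_minhash_init[OF _ l_pos A\<^sub>0[OF 0(2)]] by (simp add: init_spec_def)
next
  case (Suc t)
  then have t: "t < T" "t \<le> T" by auto
  have h: "hs i \<in> {1..N} \<rightarrow> {1..N}" using assms(1,2) by (simp add: hashes_ok_def)
  note IH = Suc.IH[OF t(2) Suc.prems(2)]
  have inv: "buf_inv l (S hs t j i)" and bm: "buffered_minhash N l (hs i) (A t j) (S hs t j i)"
    using IH by auto
  from t(1) Suc.prems(2) show ?case
  proof (cases rule: sketch_step_cases[where hs = hs])
    case other
    show ?thesis using IH unfolding other(2,3) .
  next
    case (insert x)
    show ?thesis
      unfolding insert(4,5)
      using buf_insert_correct(1)[OF inv l_pos]
        buffered_minhash_insert[OF inv l_pos bm insert(3) h A_subset[OF t(2) Suc.prems(2)]]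
      by (rule conjI)
  next
    case (delete x)
    have "buffered_minhash N l (hs i) (A t j - {x}) (buf_delete (entry_of (hs i) x) (S hs t j i))"
      using bm inv no_fault_nonempty[OF delete(3) assms(2) inv] by (rule buffered_minhash_delete)
    then show ?thesis
      unfolding delete(4,5) using buf_delete_correct(1)[OF inv] by (intro conjI)
  next
    case (init x)
    show ?thesis
      using buffered_minhash_init[OF init(5) l_pos A_subset[OF Suc.prems] h] init(5)[of i]
      unfolding init_spec_def by (intro conjI) simp_all
  qed
qed

lemma last_init_le: "last_init hs t j \<le> t"
  by (induction t) auto

lemma bound_covers_since_init:
  assumes "hashes_ok hs" "i \<in> {1..k}" "t \<le> T" "j \<in> {1..m}" "finite V"
    and "\<And>r. last_init hs t j \<le> r \<Longrightarrow> r \<le> t \<Longrightarrow> A r j \<subseteq> V"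
  shows "bound_covers l (hs i) V (S hs t j i)"
  using assms(3,4,6)
proof (induction t arbitrary: j)
  case 0
  have "init_spec l (hash_pairs (A\<^sub>0 j) (hs i)) (sketch_init l hs (query 0 (A\<^sub>0 j)) i)"
    using sketch_init_correct[OF l_pos, of "query 0 (A\<^sub>0 j)" hs i] 0 A\<^sub>0 by (simp add: query_set)
  moreover have "A\<^sub>0 j \<subseteq> V" using 0(3)[of 0] by simp
  ultimately show ?case using bound_covers_init assms(5) by simp
next
  case (Suc t)
  then have t: "t < T" "t \<le> T" by auto
  note I = sketch_invariant[OF assms(1,2) t(2) Suc.prems(2)]
  have inv: "buf_inv l (S hs t j i)" using I by blast
  have AV: "A (Suc t) j \<subseteq> V" using Suc.prems(3)[of "Suc t"] last_init_le[of hs "Suc t" j] by blast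
  \<comment> \<open>Outside the case \<open>init\<close> the period since the last initialisation
    only grows, so the hypothesis on \<open>V\<close> passes down to time \<open>t\<close>. In the
    case \<open>init\<close> the period starts afresh.\<close>
  have IH: "bound_covers l (hs i) V (S hs t j i)" if "last_init hs (Suc t) j = last_init hs t j"
    using Suc.IH[OF t(2) Suc.prems(2)] Suc.prems(3)[unfolded that] le_SucI by blast
  from t(1) Suc.prems(2) show ?case
  proof (cases rule: sketch_step_cases[where hs = hs])
    case other
    show ?thesis using IH[OF other(4)] unfolding other(3) .
  next
    case (insert x)
    have "A t j \<subseteq> V" "x \<in> V" using AV unfolding insert(4) by auto
    moreover have "buf_entries (S hs t j i) \<subseteq> hash_pairs (A t j) (hs i)"
      using I by (simp add: buffered_minhash_def)
    ultimately have "buf_entries (S hs t j i) \<subseteq> hash_pairs V (hs i)" "x \<in> V"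
      using hash_pairs_mono by blast+
    then show ?thesis
      unfolding insert(5) using bound_covers_insert[OF IH[OF insert(6)] inv l_pos assms(5)] by blast
  next
    case (delete x)
    show ?thesis unfolding delete(5) using IH[OF delete(6)] inv by (rule bound_covers_delete)
  next
    case (init x)
    show ?thesis using init(5) AV assms(5) by (rule bound_covers_init)
  qed
qed

text \<open>
  Since the last initialisation the threshold has stayed above the \<open>l\<close> smallest entries of any set
  \<open>V\<close> containing all elements seen since then, so those of them that are present are buffered.
\<close>

lemma fault_avoids_smallest:
  assumes "hashes_ok hs" "t < T" "faulty hs t" "finite V"
    and "\<And>r. last_init hs t (J t) \<le> r \<Longrightarrow> r \<le> Suc t \<Longrightarrow> A r (J t) \<subseteq> V"
  shows "\<exists>i\<in>{1..k}. smallest (hash_pairs V (hs i)) l \<inter> hash_pairs (A (Suc t) (J t)) (hs i) = {}"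
proof -
  let ?j = "J t"
  have j: "?j \<in> {1..m}" using assms(2) by (rule target_in)
  obtain x where x: "us t = Delete ?j x" "fault k hs x (S hs t ?j)"
    using assms(3) by (auto simp: faulty_def)
  then obtain i where i: "i \<in> {1..k}" "buf_size (buf_delete (entry_of (hs i) x) (S hs t ?j i)) = 0"
    by (auto simp: fault_def sketch_remove_def)
  have t: "t \<le> T" using assms(2) by simp
  note I = sketch_invariant[OF assms(1) i(1) t j]
  have inv: "buf_inv l (S hs t ?j i)" using I by blast
  have "card (buf_entries (S hs t ?j i) - {entry_of (hs i) x}) = 0"
    using buf_delete_correct(1,2)[OF inv, of "entry_of (hs i) x"] i(2) by (simp add: buf_inv_def)
  then have B: "buf_entries (S hs t ?j i) - {entry_of (hs i) x} = {}"
    by (subst (asm) card_0_eq) auto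
  have cov: "bound_covers l (hs i) V (S hs t ?j i)"
    using bound_covers_since_init[OF assms(1) i(1) t j assms(4)] assms(5) by simp
  have mem: "entry_of (hs i) y \<in> buf_entries (S hs t ?j i)"
    if "y \<in> A t ?j" "entry_of (hs i) y \<le> buf_bound (S hs t ?j i)" for y
    using I that by (simp add: buffered_minhash_def)
  have "apply_update (Delete ?j x) (A t) ?j = A t ?j - {x}" by simp
  then have "A (Suc t) ?j = A t ?j - {x}" unfolding sets_at.simps x(1)[symmetric] .
  \<comment> \<open>A remaining element with such an entry would lie below the threshold, hence be
    buffered, but nothing except the entry of \<open>x\<close> is left in the buffer.\<close>
  then have "entry_of (hs i) y \<notin> smallest (hash_pairs V (hs i)) l" if y: "y \<in> A (Suc t) ?j" for y
    using cov B mem[of y] y unfolding bound_covers_def by blast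
  then have "smallest (hash_pairs V (hs i)) l \<inter> hash_pairs (A (Suc t) ?j) (hs i) = {}"
    by (auto simp: hash_pairs_def simp del: sets_at.simps)
  then show ?thesis using i(1) by blast
qed

section \<open>Amortising initialisations against updates\<close>

lemma touches_Suc: "s \<le> t \<Longrightarrow> touches s (Suc t) j = touches s t j + (if j = J t then 1 else 0)"
proof -
  assume "s \<le> t"
  then have "{r \<in> {s..<Suc t}. J r = j} =
      (if j = J t then insert t {r \<in> {s..<t}. J r = j} else {r \<in> {s..<t}. J r = j})"
    by (auto simp: less_Suc_eq)
  then show ?thesis by (simp add: touches_def)
qed

lemma touches_self [simp]: "touches t t j = 0"
  by (simp add: touches_def)

text \<open>The second sum is the potential of an amortised analysis.\<close>

lemma sum_touches_le:
  assumes "n \<le> T"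
  shows "(\<Sum>t<n. if faulty hs t then touches (last_init hs t (J t)) (Suc t) (J t) else 0)
         + (\<Sum>j=1..m. touches (last_init hs n j) n j) \<le> n"
  using assms
proof (induction n)
  case (Suc n)
  define f where "f = (\<lambda>j. touches (last_init hs n j) n j)"
  have J: "J n \<in> {1..m}" using Suc.prems by (intro target_in) simp
  \<comment> \<open>A fault resets the potential of its set to 0 and thereby releases the amount
    added to the first sum, which includes the faulty deletion itself.\<close>
  have g: "touches (last_init hs (Suc n) j) (Suc n) j =
      (if j = J n then if faulty hs n then 0 else f j + 1 else f j)" for j
    by (simp add: touches_Suc last_init_le f_def)
  have "(\<Sum>j=1..m. touches (last_init hs (Suc n) j) (Suc n) j) =
      (if faulty hs n then 0 else f (J n) + 1) + (\<Sum>j\<in>{1..m} - {J n}. f j)"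
    unfolding g using J by (subst sum.remove[of _ "J n"]) auto
  moreover have "(\<Sum>j=1..m. f j) = f (J n) + (\<Sum>j\<in>{1..m} - {J n}. f j)"
    using J by (intro sum.remove) auto
  moreover have "touches (last_init hs n (J n)) (Suc n) (J n) = f (J n) + 1"
    using last_init_le[of hs n "J n"] by (simp add: touches_Suc f_def)
  ultimately show ?case using Suc by (simp add: f_def)
qed (simp add: touches_def)

text \<open>An element that was present in the window and is absent at its end was removed by an
  update of this set, and each update removes at most one element.\<close>

lemma window_diff:
  assumes "s \<le> t"
  shows "card ((\<Union>r\<in>{s..t}. A r j) - A t j) \<le> touches s t j"
proof -
  have "(\<Union>r\<in>{s..t}. A r j) - A t j \<subseteq> (\<lambda>r. element (us r)) ` {r \<in> {s..<t}. J r = j}"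
    using assms
  proof (induction t rule: dec_induct)
    case (step t)
    have removed: "j = J t \<and> y = element (us t)" if "y \<in> A t j" "y \<notin> A (Suc t) j" for y
      using that by (cases "us t") (auto split: if_splits)
    show ?case
    proof
      fix y assume y: "y \<in> (\<Union>r\<in>{s..Suc t}. A r j) - A (Suc t) j"
      show "y \<in> (\<lambda>r. element (us r)) ` {r \<in> {s..<Suc t}. J r = j}"
      proof (cases "y \<in> A t j")
        case True
        then have "j = J t" "y = element (us t)" using removed y by blast+
        then show ?thesis using step(1) by (intro image_eqI[of _ _ t]) auto
      next
        case False
        obtain r where r: "r \<in> {s..Suc t}" "y \<in> A r j" using y by blast
        then have "r \<noteq> Suc t" using y by blast
        then have "r \<in> {s..t}" using r(1) by simp
        then have "y \<in> (\<Union>r\<in>{s..t}. A r j) - A t j" using r(2) False by blast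
        moreover have "{r \<in> {s..<t}. J r = j} \<subseteq> {r \<in> {s..<Suc t}. J r = j}" by auto
        ultimately show ?thesis using step.IH image_mono by blast
      qed
    qed
  qed auto
  then have "card ((\<Union>r\<in>{s..t}. A r j) - A t j)
      \<le> card ((\<lambda>r. element (us r)) ` {r \<in> {s..<t}. J r = j})"
    by (intro card_mono) auto
  also have "\<dots> \<le> touches s t j" unfolding touches_def by (intro card_image_le) auto
  finally show ?thesis .
qed

section \<open>Deterministic windows and the probability of early faults\<close>

text \<open>
  The window before a deletion is as long as possible subject to few updates of the set falling into
  it. It depends on the stream but not on the hash functions, which avoids a union bound over the
  random time of the last initialisation.
\<close>

definition window_start :: "real \<Rightarrow> nat \<Rightarrow> nat" where
  "window_start C t = (LEAST s. C * real (touches s (Suc t) (J t)) \<le> real (card (A (Suc t) (J t))))"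

definition window :: "real \<Rightarrow> nat \<Rightarrow> nat set" where
  "window C t = (\<Union>r\<in>{window_start C t..Suc t}. A r (J t))"

text \<open>No state of a sketch occurs here: for fixed \<open>t\<close> the window and the
  remaining set are determined by the stream, so min-wise independence applies to each hash
  function.\<close>

definition early_fault :: "real \<Rightarrow> nat \<Rightarrow> hashes set" where
  "early_fault C t = {hs. \<exists>i\<in>{1..k}. hs i \<in>
     {h. smallest (hash_pairs (window C t) h) l \<inter> hash_pairs (A (Suc t) (J t)) h = {}}}"

lemma window_start:
  "C * real (touches (window_start C t) (Suc t) (J t)) \<le> real (card (A (Suc t) (J t)))"
  "window_start C t \<le> Suc t"
proof -
  have ex: "C * real (touches (Suc t) (Suc t) (J t)) \<le> real (card (A (Suc t) (J t)))"
    by simp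
  show "C * real (touches (window_start C t) (Suc t) (J t)) \<le> real (card (A (Suc t) (J t)))"
    unfolding window_start_def using ex by (rule LeastI)
  show "window_start C t \<le> Suc t"
    unfolding window_start_def using ex by (rule Least_le)
qed

lemma window_subset: "t < T \<Longrightarrow> window C t \<subseteq> {1..N}"
  unfolding window_def using A_subset target_in by (intro UN_least) (simp del: sets_at.simps)

text \<open>If the updates since the last initialisation do not pay for a new one, the time of that
  initialisation satisfies the condition whose least solution is \<open>window_start\<close>, so the
  window reaches back at least as far.\<close>

lemma fault_cases:
  assumes "hashes_ok hs" "t < T" "faulty hs t"
  shows "real (card (A (Suc t) (J t))) \<le> C * real (touches (last_init hs t (J t)) (Suc t) (J t))
           \<or> hs \<in> early_fault C t"
proof (cases "real (card (A (Suc t) (J t))) \<le> C * real (touches (last_init hs t (J t)) (Suc t) (J t))")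
  case False
  then have "window_start C t \<le> last_init hs t (J t)"
    unfolding window_start_def by (intro Least_le) simp
  then have "A r (J t) \<subseteq> window C t" if "last_init hs t (J t) \<le> r" "r \<le> Suc t" for r
    using that unfolding window_def by (intro UN_upper) simp
  moreover have "finite (window C t)" using window_subset[OF assms(2)] finite_subset by blast
  ultimately have "hs \<in> early_fault C t"
    using fault_avoids_smallest[OF assms] by (simp add: early_fault_def del: sets_at.simps)
  then show ?thesis ..
qed simp

lemma sum_fault_sizes_le:
  assumes "hashes_ok hs" "0 \<le> C"
  shows "(\<Sum>t<T. if faulty hs t then real (card (A (Suc t) (J t))) else 0)
           \<le> C * real T + (\<Sum>t<T. real (card (A (Suc t) (J t))) * indicator (early_fault C t) hs)"
proof -
  let ?u = "\<lambda>t. if faulty hs t then touches (last_init hs t (J t)) (Suc t) (J t) else 0"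
  have "(\<Sum>t<T. if faulty hs t then real (card (A (Suc t) (J t))) else 0)
      \<le> (\<Sum>t<T. C * real (?u t) + real (card (A (Suc t) (J t))) * indicator (early_fault C t) hs)"
  proof (rule sum_mono)
    fix t assume "t \<in> {..<T}"
    then show "(if faulty hs t then real (card (A (Suc t) (J t))) else 0)
        \<le> C * real (?u t) + real (card (A (Suc t) (J t))) * indicator (early_fault C t) hs"
      using fault_cases[OF assms(1), of t C] assms(2)
      by (auto simp: indicator_def simp del: sets_at.simps)
  qed
  also have "\<dots> = C * real (\<Sum>t<T. ?u t)
      + (\<Sum>t<T. real (card (A (Suc t) (J t))) * indicator (early_fault C t) hs)"
    by (simp only: sum.distrib sum_distrib_left of_nat_sum)
  \<comment> \<open>Each update is charged to at most one fault.\<close>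
  also have "C * real (\<Sum>t<T. ?u t) \<le> C * real T"
  proof (intro mult_left_mono assms(2))
    have "(\<Sum>t<T. ?u t) \<le> T" using sum_touches_le[of T hs] by linarith
    then show "real (\<Sum>t<T. ?u t) \<le> real T" by (simp only: of_nat_le_iff)
  qed
  finally show ?thesis by simp
qed

text \<open>Nonemptiness is required because the event is certain for an empty window. Nothing is
  lost by this, since reinitialising an empty set takes no insertion.\<close>

lemma prob_early_fault:
  assumes "min_wise_family N \<epsilon> l \<H>" "t < T" "A (Suc t) (J t) \<noteq> {}" "1 < C"
  shows "measure_pmf.prob (Pi_pmf {1..k} undefined (\<lambda>_. pmf_of_set \<H>)) (early_fault C t)
           \<le> real k * (2 / C ^ l)"
proof -
  have sub: "A (Suc t) (J t) \<subseteq> window C t"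
    using window_start(2)[of C t] unfolding window_def by (intro UN_upper) simp
  have fin: "finite (window C t)" using window_subset[OF assms(2)] finite_subset by blast
  have "C * real (card (window C t - A (Suc t) (J t)))
      \<le> C * real (touches (window_start C t) (Suc t) (J t))"
    using window_diff[OF window_start(2)] assms(4) unfolding window_def by (intro mult_left_mono) auto
  also have "\<dots> \<le> real (card (A (Suc t) (J t)))" by (rule window_start(1))
  also have "\<dots> \<le> real (card (window C t))" using sub fin by (simp add: card_mono del: sets_at.simps)
  finally have *: "C * real (card (window C t - A (Suc t) (J t))) \<le> real (card (window C t))" .
  have "window C t \<noteq> {}" using sub assms(3) by blast
  from prob_smallest_avoids[OF assms(1) window_subset[OF assms(2)] this assms(4) *]
  show ?thesis unfolding early_fault_def by (rule prob_Pi_pmf_ex_le)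
qed

text \<open>The Markov threshold \<open>T\<close> grants one unit per update and cancels the number
  of summands in the expectation.\<close>

lemma prob_early_faults:
  assumes fam: "min_wise_family N \<epsilon> l \<H>" and C: "1 < C" and T: "0 < T"
    and n: "\<And>t. t < T \<Longrightarrow> card (A (Suc t) (J t)) \<le> n"
  shows "measure_pmf.prob (Pi_pmf {1..k} undefined (\<lambda>_. pmf_of_set \<H>))
           {hs. real T \<le> (\<Sum>t<T. real (card (A (Suc t) (J t))) * indicator (early_fault C t) hs)}
         \<le> real n * (real k * (2 / C ^ l))"
proof -
  let ?P = "measure_pmf (Pi_pmf {1..k} undefined (\<lambda>_. pmf_of_set \<H>))"
  let ?f = "\<lambda>hs. \<Sum>t<T. real (card (A (Suc t) (J t))) * indicator (early_fault C t) hs"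
  have int: "integrable ?P (\<lambda>hs. real (card (A (Suc t) (J t))) * indicator (early_fault C t) hs)" for t
    by (intro integrable_mult_right) (simp add: measure_pmf.emeasure_eq_measure)
  have "measure ?P {hs \<in> space ?P. real T \<le> ?f hs} \<le> (\<integral>hs. ?f hs \<partial>?P) / real T"
    using T int by (intro integral_Markov_inequality_measure[where A = "{}"] Bochner_Integration.integrable_sum)
      (auto intro!: AE_I2 sum_nonneg simp del: sets_at.simps)
  also have "(\<integral>hs. ?f hs \<partial>?P) = (\<Sum>t<T. real (card (A (Suc t) (J t))) * measure ?P (early_fault C t))"
    using int by (subst Bochner_Integration.integral_sum) (auto simp del: sets_at.simps)
  also have "\<dots> \<le> (\<Sum>t<T. real n * (real k * (2 / C ^ l)))"
  proof (rule sum_mono)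
    fix t assume "t \<in> {..<T}"
    then have t: "t < T" by simp
    show "real (card (A (Suc t) (J t))) * measure ?P (early_fault C t)
        \<le> real n * (real k * (2 / C ^ l))"
    proof (cases "A (Suc t) (J t) = {}")
      case True
      then show ?thesis using C by (simp del: sets_at.simps)
    next
      case False
      then show ?thesis using prob_early_fault[OF fam t _ C] n[OF t] by (intro mult_mono) auto
    qed
  qed
  also have "\<dots> = real T * (real n * (real k * (2 / C ^ l)))" by simp
  finally show ?thesis using T by (simp add: divide_right_mono)
qed

section \<open>The total update time\<close>

lemma update_time_le:
  assumes "hashes_ok hs" "t < T" "0 \<le> tb"
    and \<tau>: "\<And>i x. i \<in> {1..k} \<Longrightarrow> x \<in> {1..N} \<Longrightarrow> real (\<tau> (hs i) x) \<le> tb"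
  shows "real (T_update_sketches k l \<tau> hs (query (Suc t)) (A t) (us t) (S hs t))
           \<le> 2 * op_cost k l tb
             + (if faulty hs t then real (card (A (Suc t) (J t))) else 0) * op_cost k l tb"
proof -
  have inv: "buf_inv l (S hs t (J t) i)" if "i \<in> {1..k}" for i
    using sketch_invariant[OF assms(1) that _ target_in[OF assms(2)]] assms(2) by simp
  show ?thesis
  proof (cases "us t")
    case (Insert j x)
    have x: "x \<in> {1..N}" using element_in[OF assms(2)] Insert by simp
    have j: "J t = j" using Insert by simp
    have "real (T_sketch_insert k l \<tau> hs x (S hs t j)) + 1 \<le> op_cost k l tb"
      using inv \<tau> x unfolding j by (intro T_sketch_insert_le)
    then show ?thesis using Insert by (simp add: faulty_def)
  next
    case (Delete j x)
    have x: "x \<in> {1..N}" using element_in[OF assms(2)] Delete by simp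
    have j: "J t = j" using Delete by simp
    have "A t (J t) \<subseteq> {1..N}" using assms(2) by (intro A_subset target_in) auto
    then have sub: "A t j - {x} \<subseteq> {1..N}" using j by blast
    have len: "length (query (Suc t) (A t j - {x})) = card (A t j - {x})"
      using query_set[OF sub, of "Suc t"] distinct_card by metis
    have f: "faulty hs t \<longleftrightarrow> fault k hs x (S hs t j)" using Delete by (simp add: faulty_def)
    have "real (T_sketch_delete k l \<tau> hs x (query (Suc t) (A t j - {x})) (S hs t j))
        \<le> 2 * op_cost k l tb + (if fault k hs x (S hs t j)
            then real (length (query (Suc t) (A t j - {x}))) * op_cost k l tb else 0)"
    proof (rule T_sketch_delete_le[OF l_pos assms(3)])
      show "buf_inv l (S hs t j i)" if "i \<in> {1..k}" for i using inv[OF that] j by simp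
      show "real (\<tau> (hs i) y) \<le> tb"
        if "i \<in> {1..k}" "y \<in> insert x (set (query (Suc t) (A t j - {x})))" for i y
        using \<tau>[OF that(1), of y] that(2) x sub unfolding query_set(1)[OF sub] by blast
    qed
    then show ?thesis unfolding f len using Delete by (simp split: if_splits)
  qed
qed

text \<open>In the factor \<open>3 + C\<close>, the 2 is the cost of an update apart from
  reinsertions, \<open>C\<close> pays for the faults covered by amortisation, and 1 for the early
  faults, whose total size is at most \<open>T\<close> by \<open>few\<close>.\<close>

lemma total_update_time_le:
  assumes "hashes_ok hs" "0 \<le> tb" "0 \<le> C"
    and \<tau>: "\<And>i x. i \<in> {1..k} \<Longrightarrow> x \<in> {1..N} \<Longrightarrow> real (\<tau> (hs i) x) \<le> tb"
    and few: "(\<Sum>t<T. real (card (A (Suc t) (J t))) * indicator (early_fault C t) hs) \<le> real T"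
  shows "real (total_update_time k l \<tau> hs query A\<^sub>0 us T) \<le> op_cost k l tb * (3 + C) * real T"
proof -
  let ?F = "\<lambda>t. if faulty hs t then real (card (A (Suc t) (J t))) else 0"
  have op: "0 \<le> op_cost k l tb" using assms(2) by (simp add: op_cost_def)
  have "real (total_update_time k l \<tau> hs query A\<^sub>0 us T)
      \<le> (\<Sum>t<T. 2 * op_cost k l tb + ?F t * op_cost k l tb)"
    unfolding total_update_time_def of_nat_sum
    using assms(1,2) \<tau> by (intro sum_mono update_time_le) auto
  also have "\<dots> = op_cost k l tb * (2 * real T + (\<Sum>t<T. ?F t))"
    by (simp add: sum.distrib sum_distrib_left distrib_left mult.commute del: sets_at.simps)
  also have "\<dots> \<le> op_cost k l tb * ((3 + C) * real T)"
    using sum_fault_sizes_le[OF assms(1,3)] few op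
    by (intro mult_left_mono) (simp_all add: algebra_simps del: sets_at.simps)
  finally show ?thesis by (simp add: mult.assoc)
qed

lemma card_le_max_set_size:
  assumes "t \<le> T" "j \<in> {1..m}"
  shows "card (A t j) \<le> max_set_size m A\<^sub>0 us T" "max_set_size m A\<^sub>0 us T \<le> N"
proof -
  let ?M = "{card (A t j) |t j. t \<le> T \<and> j \<in> {1..m}}"
  have "?M \<subseteq> (\<lambda>(t, j). card (A t j)) ` ({..T} \<times> {1..m})" by force
  then have fin: "finite ?M" by (rule finite_subset) simp
  then show "card (A t j) \<le> max_set_size m A\<^sub>0 us T"
    unfolding max_set_size_def using assms by (intro Max_ge) auto
  have "card (A t j) \<le> N" if "t \<le> T" "j \<in> {1..m}" for t j
    using card_mono[OF _ A_subset[OF that]] by simp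
  then show "max_set_size m A\<^sub>0 us T \<le> N"
    unfolding max_set_size_def using assms fin by (intro Max.boundedI) auto
qed

lemma prob_total_update_time:
  assumes fam: "min_wise_family N \<epsilon> l \<H>" and C: "1 < C" and m: "1 \<le> m" and tb: "0 \<le> tb"
    and \<tau>: "\<And>h x. h \<in> \<H> \<Longrightarrow> x \<in> {1..N} \<Longrightarrow> real (\<tau> h x) \<le> tb"
  shows "measure_pmf.prob (Pi_pmf {1..k} undefined (\<lambda>_. pmf_of_set \<H>))
           {hs. real (total_update_time k l \<tau> hs query A\<^sub>0 us T) \<le> op_cost k l tb * (3 + C) * real T}
         \<ge> 1 - real (max_set_size m A\<^sub>0 us T) * (real k * (2 / C ^ l))"
proof (cases "T = 0")
  \<comment> \<open>Markov's inequality divides by \<open>T\<close>; without updates the total time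
    is 0.\<close>
  case True
  then show ?thesis using C by (simp add: total_update_time_def)
next
  case False
  let ?p = "Pi_pmf {1..k} undefined (\<lambda>_. pmf_of_set \<H>)"
  let ?B = "{hs. real T \<le> (\<Sum>t<T. real (card (A (Suc t) (J t))) * indicator (early_fault C t) hs)}"
  let ?G = "{hs. real (total_update_time k l \<tau> hs query A\<^sub>0 us T) \<le> op_cost k l tb * (3 + C) * real T}"
  have H: "finite \<H>" "\<H> \<noteq> {}" "\<H> \<subseteq> {1..N} \<rightarrow> {1..N}"
    using fam by (auto simp: min_wise_family_def)
  \<comment> \<open>The components of \<open>hs\<close> are known to belong to the family only on
    the support of the product.\<close>
  have "- ?B \<inter> set_pmf ?p \<subseteq> ?G"
  proof
    fix hs assume hs: "hs \<in> - ?B \<inter> set_pmf ?p"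
    then have mem: "hs i \<in> \<H>" if "i \<in> {1..k}" for i
      using H that by (auto simp: set_Pi_pmf PiE_dflt_def)
    then have "hashes_ok hs" using H(3) unfolding hashes_ok_def by blast
    then have "real (total_update_time k l \<tau> hs query A\<^sub>0 us T) \<le> op_cost k l tb * (3 + C) * real T"
      using hs C tb mem \<tau> by (intro total_update_time_le) (auto simp del: sets_at.simps)
    then show "hs \<in> ?G" by simp
  qed
  then have "measure_pmf.prob ?p (- ?B \<inter> set_pmf ?p) \<le> measure_pmf.prob ?p ?G"
    by (intro measure_pmf.finite_measure_mono) auto
  moreover have "measure_pmf.prob ?p (- ?B \<inter> set_pmf ?p) = 1 - measure_pmf.prob ?p ?B"
    unfolding measure_Int_set_pmf using measure_pmf.prob_compl[of ?B ?p] by (simp add: Compl_eq_Diff_UNIV)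
  moreover have "measure_pmf.prob ?p ?B \<le> real (max_set_size m A\<^sub>0 us T) * (real k * (2 / C ^ l))"
    using False card_le_max_set_size(1) target_in
    by (intro prob_early_faults[OF fam C]) (simp_all del: sets_at.simps)
  ultimately show ?thesis by linarith
qed

lemma read_signature_eq:
  assumes "hashes_ok hs" "t \<le> T" "j \<in> {1..m}" "set is \<subseteq> {1..k}"
  shows "read_signature is (S hs t j) = map (\<lambda>i. minhash (hs i) (A t j)) is"
  using assms(4)
proof (induction "is")
  case (Cons i "is")
  then have "i \<in> {1..k}" by simp
  from sketch_invariant[OF assms(1) this assms(2,3)]
  have "hval (buf_min (S hs t j i)) = minhash (hs i) (A t j)"
    using finite_A[OF assms(2,3)] hval_buf_min by blast
  then show ?case using Cons by simp
qed simp

end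

section \<open>Choice of the constants\<close>

text \<open>The lower bound on \<open>l\<close> gives \<open>N ^ (q + c + 2) \<le> C ^ l\<close>. Of
  this exponent, \<open>q\<close> yields the denominator under \<open>k\<close>, \<open>c\<close>
  the decay in \<open>n\<close>, and 2 absorbs the factor \<open>2 * n\<close>, which is at most
  \<open>N * N\<close>.\<close>

lemma failure_prob_le:
  fixes a :: real and k l n N c q :: nat
  assumes "0 < a" "2 \<le> N" "a * log 2 (real N) \<le> real l" "n \<le> N"
  defines "C \<equiv> 2 powr (real (q + c + 2) / a)"
  shows "real n * (real k * (2 / C ^ l)) \<le> max 1 (real k / real N ^ q) / real n ^ c"
proof (cases "n = 0")
  case False
  have "real (q + c + 2) * log 2 (real N) = real (q + c + 2) / a * (a * log 2 (real N))"
    using assms(1) by simp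
  also have "\<dots> \<le> real (q + c + 2) / a * real l"
    using assms(1,3) by (intro mult_left_mono) auto
  finally have "2 powr (log 2 (real N) * real (q + c + 2)) \<le> 2 powr (real (q + c + 2) / a * real l)"
    by (simp add: mult.commute)
  moreover have "2 powr (log 2 (real N) * real e) = real N ^ e" for e
    using assms(2) by (subst powr_powr[symmetric]) (simp add: powr_realpow)
  moreover have "2 powr (real (q + c + 2) / a * real l) = C ^ l"
    unfolding C_def by (subst powr_powr[symmetric]) (simp add: powr_realpow)
  ultimately have CN: "real N ^ (q + c + 2) \<le> C ^ l" by metis
  have "2 * real n \<le> real N * real N" using assms(2,4) by (intro mult_mono) auto
  then have "2 * real n * real n ^ c \<le> real N ^ 2 * real N ^ c"
    using assms(4) by (intro mult_mono power_mono) (auto simp: power2_eq_square)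
  then have "2 * real n * real n ^ c * real N ^ q \<le> real N ^ 2 * real N ^ c * real N ^ q"
    by (intro mult_right_mono) auto
  also have "\<dots> \<le> C ^ l" using CN by (simp add: power_add power2_eq_square algebra_simps)
  finally have "2 * real n * real n ^ c * real N ^ q \<le> C ^ l" .
  then have "real k * (2 * real n * real n ^ c * real N ^ q) \<le> real k * C ^ l"
    by (intro mult_left_mono) auto
  moreover have "0 < C ^ l" "0 < real N ^ q" "0 < real n ^ c"
    using False assms(2) by (auto simp: C_def)
  ultimately have "real n * (real k * (2 / C ^ l)) \<le> (real k / real N ^ q) / real n ^ c"
    by (simp add: field_simps)
  also have "\<dots> \<le> max 1 (real k / real N ^ q) / real n ^ c"
    by (intro divide_right_mono) auto
  finally show ?thesis .
qed simp

text \<open>\<open>K\<close> is chosen before every parameter of an instance. Each of the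
  \<open>k\<close> hash functions is a chance to fail, so the failure probability is bounded by
  \<open>1 / n ^ c\<close> as long as \<open>k \<le> N ^ q\<close> and grows in proportion to
  \<open>k\<close> beyond that. The offsets \<open>1 +\<close> in the bounds on
  \<open>\<tau>\<close> and \<open>store\<close> keep them of order at least \<open>l\<close> when
  \<epsilon> is close to 1.\<close>

theorem theorem4p9:
  fixes a b \<epsilon>\<^sub>0 c\<^sub>h :: real and c q :: nat
  assumes "0 < a" "a \<le> b" "0 < \<epsilon>\<^sub>0" "0 < c\<^sub>h"
  shows "\<exists>K>0. \<forall>(N::nat) (k::nat) (l::nat) (m::nat) (\<epsilon>::real) \<H> \<tau> store
             (A\<^sub>0 :: nat \<Rightarrow> nat set) (us :: nat \<Rightarrow> update) (T::nat) query.
           N \<ge> 2 \<longrightarrow> k \<ge> 1 \<longrightarrow> m \<ge> 1 \<longrightarrow>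
           a * log 2 (real N) \<le> real l \<longrightarrow> real l \<le> b * log 2 (real N) \<longrightarrow>
           \<epsilon>\<^sub>0 \<le> \<epsilon> \<longrightarrow> min_wise_family N \<epsilon> l \<H> \<longrightarrow>
           (\<forall>h\<in>\<H>. \<forall>x\<in>{1..N}. real (\<tau> h x) \<le> c\<^sub>h * (real l * (1 + ln (1 / \<epsilon>)))) \<longrightarrow>
           (\<forall>h\<in>\<H>. real (store h) \<le> c\<^sub>h * (real l * (1 + ln (1 + ln (1 / \<epsilon>))) + ln (1 / \<epsilon>))) \<longrightarrow>
           (\<forall>j\<in>{1..m}. A\<^sub>0 j \<subseteq> {1..N}) \<longrightarrow>
           (\<forall>t<T. valid_update N m (us t)) \<longrightarrow>
           valid_query N query \<longrightarrow>
             (\<forall>hs. (\<forall>i\<in>{1..k}. hs i \<in> \<H>) \<longrightarrow> (\<forall>t\<le>T. \<forall>j\<in>{1..m}.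
                let A = sets_at A\<^sub>0 us t j; S = sketches_at k l hs query A\<^sub>0 us t j in
                  (\<forall>i\<in>{1..k}. buffered_minhash N l (hs i) A (S i)) \<and>
                  real ((\<Sum>i=1..k. store (hs i)) + sketch_words k S) \<le> K * (real k * log 2 (real N)) \<and>
                  read_signature [1..<Suc k] S = map (\<lambda>i. minhash (hs i) A) [1..<Suc k] \<and>
                  real (T_read_signature [1..<Suc k] S) \<le> K * real k)) \<and>
             (let n = max_set_size m A\<^sub>0 us T in
                measure_pmf.prob (Pi_pmf {1..k} undefined (\<lambda>_. pmf_of_set \<H>))
                    {hs. real (total_update_time k l \<tau> hs query A\<^sub>0 us T)
                           \<le> K * (real k * log 2 (real N)) * real T}
                  \<ge> 1 - max 1 (real k / real N ^ q) / real n ^ c)"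
proof -
  \<comment> \<open>A common bound on \<open>ln (1 / \<epsilon>)\<close> for all admissible
    \<epsilon>. The maximum keeps it nonnegative when \<open>\<epsilon>\<^sub>0\<close> exceeds
    1.\<close>
  define \<kappa> where "\<kappa> = max 0 (ln (1 / \<epsilon>\<^sub>0))"
  define C where "C = 2 powr (real (q + c + 2) / a)"
  \<comment> \<open>The 13 is the 11 inside \<open>op_cost\<close> and its additive 2, absorbed by
    \<open>k \<ge> 1\<close>; constants are then multiplied by
    \<open>log 2 N \<ge> 1\<close>.\<close>
  define K\<^sub>1 where "K\<^sub>1 = c\<^sub>h * b * (1 + \<kappa>) + 5 * b + 13"
  define K\<^sub>2 where "K\<^sub>2 = c\<^sub>h * (b * (1 + ln (1 + \<kappa>)) + \<kappa>) + 5 * b + 6"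
  \<comment> \<open>The summands serve the update time, the memory, and the reading of the signature
    in \<open>k + 1 \<le> 2 * k\<close> units.\<close>
  define K where "K = K\<^sub>1 * (3 + C) + K\<^sub>2 + 2"
  have b: "0 < b" and \<kappa>: "0 \<le> \<kappa>" using assms by (auto simp: \<kappa>_def)
  have C: "1 < C" unfolding C_def using assms(1) by (intro gr_one_powr) auto
  have K1: "0 \<le> K\<^sub>1" and K2: "0 \<le> K\<^sub>2"
    using b \<kappa> assms(4) by (auto simp: K\<^sub>1_def K\<^sub>2_def intro!: add_nonneg_nonneg mult_nonneg_nonneg)
  have K: "0 < K" "K\<^sub>1 * (3 + C) \<le> K" "K\<^sub>2 \<le> K" "2 \<le> K"
    using K1 K2 C by (auto simp: K_def intro: add_nonneg_nonneg add_nonneg_pos)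
  show ?thesis
  proof (intro exI[of _ K] conjI K(1) allI impI)
    fix N k l m :: nat and \<epsilon> :: real and \<H> and \<tau> :: eval_time and store :: "(nat \<Rightarrow> nat) \<Rightarrow> nat"
      and A\<^sub>0 :: "nat \<Rightarrow> nat set" and us :: "nat \<Rightarrow> update" and T :: nat and query
      and hs :: hashes and t :: nat
    assume k: "k \<ge> 1" and l: "real l \<le> b * log 2 (real N)" and N: "N \<ge> 2"
      and \<epsilon>: "\<epsilon>\<^sub>0 \<le> \<epsilon>" and fam: "min_wise_family N \<epsilon> l \<H>"
      and store: "\<forall>h\<in>\<H>. real (store h) \<le> c\<^sub>h * (real l * (1 + ln (1 + ln (1 / \<epsilon>))) + ln (1 / \<epsilon>))"
      and A0: "\<forall>j\<in>{1..m}. A\<^sub>0 j \<subseteq> {1..N}" and us: "\<forall>t<T. valid_update N m (us t)"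
      and query: "valid_query N query" and hs: "\<forall>i\<in>{1..k}. hs i \<in> \<H>" and t: "t \<le> T"
    have l0: "2 \<le> l" using fam by (simp add: min_wise_family_def)
    interpret sketch_stream N k l m A\<^sub>0 us T query
      using A0 us query l0 by unfold_locales auto
    have ok: "hashes_ok hs" using hs fam unfolding hashes_ok_def min_wise_family_def by blast
    have L: "1 \<le> log 2 (real N)" using N by (simp add: le_log_iff)
    have ln\<epsilon>: "0 \<le> ln (1 / \<epsilon>)" "ln (1 / \<epsilon>) \<le> \<kappa>"
    proof -
      have "0 < \<epsilon>" "\<epsilon> < 1" using fam by (auto simp: min_wise_family_def)
      then show "0 \<le> ln (1 / \<epsilon>)" "ln (1 / \<epsilon>) \<le> \<kappa>"
        using \<epsilon> assms(3) unfolding \<kappa>_def by (auto simp: ln_div)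
    qed
    show "\<forall>j\<in>{1..m}. let A = sets_at A\<^sub>0 us t j; S = sketches_at k l hs query A\<^sub>0 us t j in
                  (\<forall>i\<in>{1..k}. buffered_minhash N l (hs i) A (S i)) \<and>
                  real ((\<Sum>i=1..k. store (hs i)) + sketch_words k S) \<le> K * (real k * log 2 (real N)) \<and>
                  read_signature [1..<Suc k] S = map (\<lambda>i. minhash (hs i) A) [1..<Suc k] \<and>
                  real (T_read_signature [1..<Suc k] S) \<le> K * real k"
      unfolding Let_def
    proof (intro ballI conjI)
      fix j assume j: "j \<in> {1..m}"
      note inv = sketch_invariant[OF ok _ t j]
      show "buffered_minhash N l (hs i) (A t j) (S hs t j i)" if "i \<in> {1..k}" for i
        using inv[OF that] by blast
      have "real (sketch_words k (S hs t j)) \<le> real (k * (5 * l + 6))"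
        using inv by (intro of_nat_mono sketch_words_le) blast
      moreover have "real (\<Sum>i=1..k. store (hs i)) \<le> real k * (c\<^sub>h * (b * (1 + ln (1 + \<kappa>)) + \<kappa>) * log 2 (real N))"
      proof -
        have "real (store (hs i)) \<le> c\<^sub>h * (b * (1 + ln (1 + \<kappa>)) + \<kappa>) * log 2 (real N)"
          if "i \<in> {1..k}" for i
        proof -
          have "real (store (hs i)) \<le> c\<^sub>h * (real l * (1 + ln (1 + ln (1 / \<epsilon>))) + ln (1 / \<epsilon>))"
            using store hs that by blast
          also have "\<dots> \<le> c\<^sub>h * ((b * log 2 (real N)) * (1 + ln (1 + \<kappa>)) + \<kappa> * log 2 (real N))"
          proof (intro mult_left_mono add_mono mult_mono)
            have "\<kappa> * 1 \<le> \<kappa> * log 2 (real N)" using \<kappa> L by (intro mult_left_mono)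
            then show "ln (1 / \<epsilon>) \<le> \<kappa> * log 2 (real N)" using ln\<epsilon> by simp
            show "ln (1 + ln (1 / \<epsilon>)) \<le> ln (1 + \<kappa>)" using ln\<epsilon> by (subst ln_le_cancel_iff) linarith+
            have "0 \<le> ln (1 + ln (1 / \<epsilon>))" using ln\<epsilon> by (intro ln_ge_zero) simp
            then show "0 \<le> 1 + ln (1 + ln (1 / \<epsilon>))" by simp
          qed (use l b L assms(4) in auto)
          finally show ?thesis by (simp add: algebra_simps)
        qed
        then have "(\<Sum>i=1..k. real (store (hs i)))
            \<le> (\<Sum>i=1..k. c\<^sub>h * (b * (1 + ln (1 + \<kappa>)) + \<kappa>) * log 2 (real N))"
          by (intro sum_mono)
        then show ?thesis by simp
      qed
      moreover have "real (k * (5 * l + 6)) \<le> real k * ((5 * b + 6) * log 2 (real N))"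
        unfolding of_nat_mult using l L by (intro mult_left_mono) (auto simp: algebra_simps)
      ultimately have "real ((\<Sum>i=1..k. store (hs i)) + sketch_words k (S hs t j))
          \<le> K\<^sub>2 * (real k * log 2 (real N))"
        by (simp add: K\<^sub>2_def algebra_simps)
      also have "\<dots> \<le> K * (real k * log 2 (real N))" using K(3) L by (intro mult_right_mono) auto
      finally show "real ((\<Sum>i=1..k. store (hs i)) + sketch_words k (S hs t j)) \<le> K * (real k * log 2 (real N))" .
      show "read_signature [1..<Suc k] (S hs t j) = map (\<lambda>i. minhash (hs i) (A t j)) [1..<Suc k]"
        using ok t j by (intro read_signature_eq) auto
      have "2 * real k \<le> K * real k" using K(4) by (intro mult_right_mono) auto
      moreover have "real (T_read_signature [1..<Suc k] (S hs t j)) = real k + 1"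
        by (simp add: T_read_signature_eq del: upt_Suc)
      moreover have "1 \<le> real k" using k by simp
      ultimately show "real (T_read_signature [1..<Suc k] (S hs t j)) \<le> K * real k"
        by linarith
    qed
  next
    fix N k l m :: nat and \<epsilon> :: real and \<H> and \<tau> :: eval_time and store :: "(nat \<Rightarrow> nat) \<Rightarrow> nat"
      and A\<^sub>0 :: "nat \<Rightarrow> nat set" and us :: "nat \<Rightarrow> update" and T :: nat and query
    assume k: "k \<ge> 1" and m: "m \<ge> 1" and l: "real l \<le> b * log 2 (real N)" and N: "N \<ge> 2"
      and al: "a * log 2 (real N) \<le> real l"
      and \<epsilon>: "\<epsilon>\<^sub>0 \<le> \<epsilon>" and fam: "min_wise_family N \<epsilon> l \<H>"
      and \<tau>: "\<forall>h\<in>\<H>. \<forall>x\<in>{1..N}. real (\<tau> h x) \<le> c\<^sub>h * (real l * (1 + ln (1 / \<epsilon>)))"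
      and A0: "\<forall>j\<in>{1..m}. A\<^sub>0 j \<subseteq> {1..N}" and us: "\<forall>t<T. valid_update N m (us t)"
      and query: "valid_query N query"
    have l0: "2 \<le> l" using fam by (simp add: min_wise_family_def)
    interpret sketch_stream N k l m A\<^sub>0 us T query
      using A0 us query l0 by unfold_locales auto
    let ?p = "Pi_pmf {1..k} undefined (\<lambda>_. pmf_of_set \<H>)"
    have L: "1 \<le> log 2 (real N)" using N by (simp add: le_log_iff)
    have ln\<epsilon>: "0 \<le> ln (1 / \<epsilon>)" "ln (1 / \<epsilon>) \<le> \<kappa>"
    proof -
      have "0 < \<epsilon>" "\<epsilon> < 1" using fam by (auto simp: min_wise_family_def)
      then show "0 \<le> ln (1 / \<epsilon>)" "ln (1 / \<epsilon>) \<le> \<kappa>"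
        using \<epsilon> assms(3) unfolding \<kappa>_def by (auto simp: ln_div)
    qed
    define tb where "tb = c\<^sub>h * (real l * (1 + ln (1 / \<epsilon>)))"
    have tb0: "0 \<le> tb" using assms(4) ln\<epsilon> by (simp add: tb_def)
    have "tb \<le> c\<^sub>h * ((b * log 2 (real N)) * (1 + \<kappa>))"
      unfolding tb_def using assms(4) ln\<epsilon> l b L by (intro mult_left_mono mult_mono) auto
    then have tb: "tb + 5 * real l + 13 \<le> c\<^sub>h * ((b * log 2 (real N)) * (1 + \<kappa>))
        + 5 * (b * log 2 (real N)) + 13 * log 2 (real N)"
      using l L by linarith
    have "op_cost k l tb \<le> real k * (tb + 5 * real l + 13)"
      using k by (simp add: op_cost_def algebra_simps)
    also have "\<dots> \<le> real k * (c\<^sub>h * ((b * log 2 (real N)) * (1 + \<kappa>))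
        + 5 * (b * log 2 (real N)) + 13 * log 2 (real N))"
      using tb by (intro mult_left_mono) auto
    finally have op: "op_cost k l tb \<le> K\<^sub>1 * (real k * log 2 (real N))"
      by (simp add: K\<^sub>1_def algebra_simps)
    have "op_cost k l tb * (3 + C) \<le> K\<^sub>1 * (real k * log 2 (real N)) * (3 + C)"
      using op C by (intro mult_right_mono) auto
    also have "\<dots> = K\<^sub>1 * (3 + C) * (real k * log 2 (real N))" by simp
    also have "\<dots> \<le> K * (real k * log 2 (real N))" using K(2) L by (intro mult_right_mono) auto
    finally have le: "op_cost k l tb * (3 + C) * real T \<le> K * (real k * log 2 (real N)) * real T"
      by (intro mult_right_mono) auto
    let ?n = "max_set_size m A\<^sub>0 us T"
    \<comment> \<open>Time 0 and set 1, which exists because \<open>m \<ge> 1\<close>, show that the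
      maximum ranges over a nonempty set.\<close>
    have "?n \<le> N" using card_le_max_set_size(2)[of 0 1] m by simp
    then have "1 - max 1 (real k / real N ^ q) / real ?n ^ c \<le> 1 - real ?n * (real k * (2 / C ^ l))"
      using failure_prob_le[OF assms(1) N al, of ?n k q c] by (simp add: C_def)
    also have "\<dots> \<le> measure_pmf.prob ?p {hs. real (total_update_time k l \<tau> hs query A\<^sub>0 us T)
        \<le> op_cost k l tb * (3 + C) * real T}"
      using \<tau> by (intro prob_total_update_time[OF fam C m tb0]) (simp add: tb_def)
    also have "\<dots> \<le> measure_pmf.prob ?p {hs. real (total_update_time k l \<tau> hs query A\<^sub>0 us T)
        \<le> K * (real k * log 2 (real N)) * real T}"
      using le by (intro measure_pmf.finite_measure_mono) auto
    finally show "let n = ?n in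
                measure_pmf.prob ?p
                    {hs. real (total_update_time k l \<tau> hs query A\<^sub>0 us T)
                           \<le> K * (real k * log 2 (real N)) * real T}
                  \<ge> 1 - max 1 (real k / real N ^ q) / real n ^ c"
      unfolding Let_def .
  qed
qed

end
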